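(* Let $X$ be an infinite-dimensional complex Banach space and let $T\in L(X)$. Then the following statements are equivalent: (i) $T$ satisfies property $(UW_{E})$ and $E_a(T)\cap\sigma_{uw}(T)=\emptyset$; (ii) $T$ satisfies property $(Z_{E_a})$ and $\sigma_w(T)\setminus\sigma_{uw}(T)=\sigma(T)\setminus\sigma_a(T)$; (iii) $T$ satisfies property $(Z_{E_a})$ and $\Delta_a(T)\cap\sigma_w(T)=\emptyset$.
   Context: $L(X)$ is the algebra of bounded linear operators on $X$. For $T\in L(X)$, $\alpha(T)=\dim \mathcal{N}(T)$ (kernel) and $\beta(T)=\operatorname{codim}\mathcal{R}(T)$ (range); the index is $\alpha(T)-\beta(T)$. $\sigma(T)$ is the spectrum, $\sigma_a(T)$ the approximate point spectrum, $\sigma_p(T)$ the set of eigenvalues of $T$, and $\mathrm{iso}\,A$ denotes the set of isolated points of $A\subset\mathbb{C}$. $T$ is upper semi-Fredholm if $\mathcal{R}(T)$ is closed and $\alpha(T)<\infty$. Weyl spectrum: $\sigma_w(T)$ is the set of $\lambda\in\mathbb{C}$ such that $T-\lambda I$ is not Fredholm of index $0$. Upper semi-Weyl spectrum: $\sigma_{uw}(T)$ is the set of $\lambda$ such that $T-\lambda I$ is not an upper semi-Fredholm operator of index $\le 0$. Put $\Delta(T)=\sigma(T)\setminus\sigma_w(T)$, $\Delta_a(T)=\sigma_a(T)\setminus\sigma_{uw}(T)$, $E(T)=\mathrm{iso}\,\sigma(T)\cap\sigma_p(T)$ and $E_a(T)=\mathrm{iso}\,\sigma_a(T)\cap\sigma_p(T)$.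 $T$ satisfies property $(UW_{E})$ if $\Delta_a(T)=E(T)$; $T$ satisfies property $(Z_{E_a})$ if $\Delta(T)=E_a(T)$. *)

theory Defs
  imports "HOL-Analysis.Analysis"
begin

section \<open>Complex Banach spaces\<close>

class scaleC = scaleR +
  fixes scaleC :: "complex \<Rightarrow> 'a \<Rightarrow> 'a"  (infixr \<open>*\<^sub>C\<close> 75)

class complex_normed_vector = real_normed_vector + scaleC +
  assumes scaleC_add_right: "a *\<^sub>C (x + y) = a *\<^sub>C x + a *\<^sub>C y"
    and scaleC_add_left: "(a + b) *\<^sub>C x = a *\<^sub>C x + b *\<^sub>C x"
    and scaleC_scaleC: "a *\<^sub>C b *\<^sub>C x = (a * b) *\<^sub>C x"
    and scaleC_of_real: "of_real r *\<^sub>C x = r *\<^sub>R x"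
    and norm_scaleC: "norm (a *\<^sub>C x) = cmod a * norm x"

class cbanach = complex_normed_vector + complete_space

subclass (in cbanach) banach ..

global_interpretation complex_vector: vector_space "scaleC :: complex \<Rightarrow> 'a \<Rightarrow> 'a::complex_normed_vector"
proof
  fix x :: 'a
  show "1 *\<^sub>C x = x"
    using scaleC_of_real[of 1 x] by simp
qed (simp_all add: scaleC_add_right scaleC_add_left scaleC_scaleC)

section \<open>Dimension and codimension\<close>

text \<open>The library's \<open>dim\<close> is \<open>0\<close> on infinite-dimensional spaces, hence the case distinction.\<close>

definition cdim :: "'a::complex_normed_vector set \<Rightarrow> enat" where
  "cdim S = (if \<exists>B. finite B \<and> S \<subseteq> complex_vector.span B
             then enat (complex_vector.dim S) else \<infinity>)"

text \<open>The dimension of the quotient of the whole space by a subspace \<open>S\<close>: the least number of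
  vectors whose cosets span that quotient (\<open>\<infinity>\<close> if no finite set does). By \<open>ccodim_complement\<close>
  below it is the dimension of any algebraic complement of \<open>S\<close>.\<close>

definition ccodim :: "'a::complex_normed_vector set \<Rightarrow> enat" where
  "ccodim S = (INF B \<in> {B. finite B \<and> complex_vector.span (S \<union> B) = UNIV}. enat (card B))"

lemma ccodim_complement:
  fixes S C :: "'a::complex_normed_vector set"
  assumes S: "complex_vector.subspace S" and C: "complex_vector.subspace C"
    and disj: "S \<inter> C = {0}" and sum: "\<And>x. \<exists>s\<in>S. \<exists>c\<in>C. x = s + c"
  shows "ccodim S = cdim C"
proof (rule antisym)
  show "ccodim S \<le> cdim C"
  proof (cases "\<exists>B. finite B \<and> C \<subseteq> complex_vector.span B")
    case True
    then obtain B0 where B0: "finite B0" "C \<subseteq> complex_vector.span B0" by blast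
    obtain B where B: "B \<subseteq> C" "complex_vector.independent B" "C \<subseteq> complex_vector.span B"
      "card B = complex_vector.dim C"
      by (rule complex_vector.basis_exists)
    have fin: "finite B"
      using complex_vector.independent_span_bound[OF B0(1) B(2)] B(1) B0(2) by blast
    have "x \<in> complex_vector.span (S \<union> B)" for x
    proof -
      obtain s c where sc: "s \<in> S" "c \<in> C" "x = s + c" using sum by blast
      have "s \<in> complex_vector.span (S \<union> B)"
        using sc by (simp add: complex_vector.span_base)
      moreover have "c \<in> complex_vector.span (S \<union> B)"
        using sc B(3) complex_vector.span_mono[of B "S \<union> B"] by blast
      ultimately show ?thesis using sc by (simp add: complex_vector.span_add)
    qed
    then have "complex_vector.span (S \<union> B) = UNIV" by blast
    then have "ccodim S \<le> enat (card B)"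
      unfolding ccodim_def using fin by (intro INF_lower) simp
    then show ?thesis using True B(4) by (simp add: cdim_def)
  next
    case False
    then have "cdim C = \<infinity>" unfolding cdim_def by (rule if_not_P)
    then show ?thesis by simp
  qed
next
  show "cdim C \<le> ccodim S"
    unfolding ccodim_def
  proof (rule INF_greatest)
    fix B assume "B \<in> {B. finite B \<and> complex_vector.span (S \<union> B) = UNIV}"
    then have fin: "finite B" and sp: "complex_vector.span (S \<union> B) = UNIV" by auto
    obtain p where p: "\<And>b. p b \<in> C \<and> b - p b \<in> S"
    proof -
      have "\<exists>c. c \<in> C \<and> b - c \<in> S" for b
        using sum[of b] by (metis add_diff_cancel_right')
      then show thesis using that by metis
    qed
    have sub: "C \<subseteq> complex_vector.span (p ` B)"
    proof
      fix c assume c: "c \<in> C"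
      have "S \<union> B \<subseteq> complex_vector.span (S \<union> p ` B)"
      proof
        fix x assume "x \<in> S \<union> B"
        then show "x \<in> complex_vector.span (S \<union> p ` B)"
        proof
          assume "x \<in> S" then show ?thesis by (simp add: complex_vector.span_base)
        next
          assume x: "x \<in> B"
          have "x = (x - p x) + p x" by simp
          moreover have "x - p x \<in> complex_vector.span (S \<union> p ` B)"
            using p[of x] by (simp add: complex_vector.span_base)
          moreover have "p x \<in> complex_vector.span (S \<union> p ` B)"
            using x by (simp add: complex_vector.span_base)
          ultimately show ?thesis by (metis complex_vector.span_add)
        qed
      qed
      then have "complex_vector.span (S \<union> B) \<subseteq> complex_vector.span (S \<union> p ` B)"
        by (simp add: complex_vector.span_minimal)
      then have "c \<in> complex_vector.span (S \<union> p ` B)" using sp by blast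
      then obtain s d where sd: "s \<in> complex_vector.span S"
        "d \<in> complex_vector.span (p ` B)" "c = s + d"
        by (auto simp: complex_vector.span_Un)
      have "s \<in> S" using sd(1) S by (metis complex_vector.span_eq_iff)
      moreover have "d \<in> C"
        using sd(2) C p complex_vector.span_minimal[of "p ` B" C] by blast
      then have "s \<in> C" using sd(3) c C complex_vector.subspace_diff[of C c d] by simp
      ultimately have "s = 0" using disj by blast
      then show "c \<in> complex_vector.span (p ` B)" using sd by simp
    qed
    have "complex_vector.dim C \<le> card (p ` B)"
      using sub fin by (intro complex_vector.dim_le_card) auto
    also have "\<dots> \<le> card B" using fin by (rule card_image_le)
    finally show "cdim C \<le> enat (card B)"
      using sub fin by (auto simp: cdim_def)
  qed
qed

section \<open>Bounded operators and their spectra\<close>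

definition bounded_clinear :: "('a::complex_normed_vector \<Rightarrow> 'a) \<Rightarrow> bool" where
  "bounded_clinear T \<longleftrightarrow> bounded_linear T \<and> (\<forall>a x. T (a *\<^sub>C x) = a *\<^sub>C T x)"

definition op_shift :: "('a::complex_normed_vector \<Rightarrow> 'a) \<Rightarrow> complex \<Rightarrow> 'a \<Rightarrow> 'a" where
  "op_shift T l = (\<lambda>x. T x - l *\<^sub>C x)"

definition nullity :: "('a::complex_normed_vector \<Rightarrow> 'a) \<Rightarrow> enat" where
  "nullity T = cdim {x. T x = 0}"

definition deficiency :: "('a::complex_normed_vector \<Rightarrow> 'a) \<Rightarrow> enat" where
  "deficiency T = ccodim (range T)"

text \<open>Only meaningful if \<open>nullity T\<close> or \<open>deficiency T\<close> is finite, as it is in all uses below.\<close>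

definition fredholm_index :: "('a::complex_normed_vector \<Rightarrow> 'a) \<Rightarrow> ereal" where
  "fredholm_index T = ereal_of_enat (nullity T) - ereal_of_enat (deficiency T)"

definition upper_semi_fredholm :: "('a::complex_normed_vector \<Rightarrow> 'a) \<Rightarrow> bool" where
  "upper_semi_fredholm T \<longleftrightarrow> closed (range T) \<and> nullity T < \<infinity>"

definition fredholm :: "('a::complex_normed_vector \<Rightarrow> 'a) \<Rightarrow> bool" where
  "fredholm T \<longleftrightarrow> upper_semi_fredholm T \<and> deficiency T < \<infinity>"

definition spectrum :: "('a::complex_normed_vector \<Rightarrow> 'a) \<Rightarrow> complex set" where
  "spectrum T = {l. \<not> (\<exists>S. bounded_clinear S \<and> S \<circ> op_shift T l = id \<and> op_shift T l \<circ> S = id)}"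

definition approx_point_spectrum :: "('a::complex_normed_vector \<Rightarrow> 'a) \<Rightarrow> complex set" where
  "approx_point_spectrum T =
     {l. \<exists>x :: nat \<Rightarrow> 'a. (\<forall>n. norm (x n) = 1) \<and> (\<lambda>n. op_shift T l (x n)) \<longlonglongrightarrow> 0}"

definition point_spectrum :: "('a::complex_normed_vector \<Rightarrow> 'a) \<Rightarrow> complex set" where
  "point_spectrum T = {l. \<exists>x. x \<noteq> 0 \<and> T x = l *\<^sub>C x}"

definition weyl_spectrum :: "('a::complex_normed_vector \<Rightarrow> 'a) \<Rightarrow> complex set" where
  "weyl_spectrum T = {l. \<not> (fredholm (op_shift T l) \<and> fredholm_index (op_shift T l) = 0)}"

definition upper_semi_weyl_spectrum :: "('a::complex_normed_vector \<Rightarrow> 'a) \<Rightarrow> complex set" where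
  "upper_semi_weyl_spectrum T =
     {l. \<not> (upper_semi_fredholm (op_shift T l) \<and> fredholm_index (op_shift T l) \<le> 0)}"

definition isolated_points :: "complex set \<Rightarrow> complex set" where
  "isolated_points A = {z. z isolated_in A}"

definition Delta :: "('a::complex_normed_vector \<Rightarrow> 'a) \<Rightarrow> complex set" where
  "Delta T = spectrum T - weyl_spectrum T"

definition Delta_a :: "('a::complex_normed_vector \<Rightarrow> 'a) \<Rightarrow> complex set" where
  "Delta_a T = approx_point_spectrum T - upper_semi_weyl_spectrum T"

definition E_set :: "('a::complex_normed_vector \<Rightarrow> 'a) \<Rightarrow> complex set" where
  "E_set T = isolated_points (spectrum T) \<inter> point_spectrum T"

definition E_a_set :: "('a::complex_normed_vector \<Rightarrow> 'a) \<Rightarrow> complex set" where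
  "E_a_set T = isolated_points (approx_point_spectrum T) \<inter> point_spectrum T"

definition property_UWE :: "('a::complex_normed_vector \<Rightarrow> 'a) \<Rightarrow> bool" where
  "property_UWE T \<longleftrightarrow> Delta_a T = E_set T"

definition property_ZEa :: "('a::complex_normed_vector \<Rightarrow> 'a) \<Rightarrow> bool" where
  "property_ZEa T \<longleftrightarrow> Delta T = E_a_set T"

end

theory Submission
  imports Defs
begin

text \<open>
  The equivalence of the last two statements is set algebra. A point of the spectrum outside the
  approximate point spectrum belongs to an injective operator with closed proper range, so it lies
  in the Weyl but not in the upper semi-Weyl spectrum. The remaining points of
  \<open>weyl_spectrum T - upper_semi_weyl_spectrum T\<close> form
  \<open>Delta_a T \<inter> weyl_spectrum T\<close>, and the two sets in the second statement agree exactly when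
  there are none.

  The equivalence with the first statement needs two facts about the index of \<open>T - l\<close>:

  \<^item> if \<open>T - l\<close> is upper semi-Fredholm of index \<open>\<le> 0\<close> and \<open>l\<close> is a limit of points of the
    resolvent set, then the index is \<open>0\<close> (\<open>upper_semi_weyl_near_resolvent_imp_weyl\<close>);
  \<^item> if \<open>T - l\<close> is Fredholm of index \<open>0\<close>, then near \<open>l\<close> the spectrum and the approximate point
    spectrum coincide (\<open>spectrum_eq_approx_point_near_weyl\<close>).

  The first puts \<open>E_set T - upper_semi_weyl_spectrum T\<close> into \<open>Delta T\<close>; by the second, a
  point of \<open>E_a_set T\<close> outside the Weyl spectrum is isolated in the whole spectrum. With
  \<open>E_set T \<subseteq> E_a_set T\<close> and \<open>Delta T \<subseteq> Delta_a T\<close>, which always hold, either statement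
  makes these four sets equal.

  Both facts are special cases of the stability of the index, and both come from finite-rank
  perturbations. An operator \<open>S\<close> with closed range and \<open>nullity S \<le> deficiency S\<close>,
  \<open>nullity S\<close> finite, can be made bounded below by adding an operator \<open>F\<close> of finite rank which
  maps the kernel injectively into a complement of the range; \<open>S + F\<close> is onto exactly when the
  index of \<open>S\<close> is \<open>0\<close> (\<open>finite_rank_reduction\<close>). Being bounded below, and being bounded below
  and onto, survive small multiples of the identity. Finally, an injective sum of
  an invertible operator and one of finite rank is onto (\<open>bij_plus_finite_rank_inj_imp_surj\<close>).
  For the second fact, \<open>T - m\<close> is such a sum when \<open>m\<close> is near \<open>l\<close>; for the first, \<open>T - m + F\<close>
  is one when \<open>m\<close> is a nearby resolvent point, and its surjectivity passes back to \<open>T - l + F\<close>.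

  To build \<open>F\<close>, bounded functionals that do not vanish on the kernel are required, so a form of the
  Hahn-Banach theorem is proved; that an injective operator with closed range is bounded below is
  the open mapping theorem.
\<close>

section \<open>Bounded functionals\<close>

definition sublinear :: "('a::real_vector \<Rightarrow> real) \<Rightarrow> bool" where
  "sublinear q \<longleftrightarrow> (\<forall>x y. q (x + y) \<le> q x + q y) \<and> (\<forall>r x. 0 \<le> r \<longrightarrow> q (r *\<^sub>R x) = r * q x)"

lemma sublinear_zero: "sublinear q \<Longrightarrow> q 0 = 0"
  unfolding sublinear_def by (metis order_refl mult_zero_left scaleR_zero_left)

lemma sublinear_ge: "sublinear q \<Longrightarrow> - q (- x) \<le> q x"
proof -
  assume q: "sublinear q"
  then have "q (x + - x) \<le> q x + q (- x)" unfolding sublinear_def by blast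
  then show ?thesis using sublinear_zero[OF q] by simp
qed

text \<open>The functional \<open>tilt q e\<close> is sublinear and below \<open>q\<close>, and its value at \<open>- e\<close> is at most
  \<open>- q e\<close>. It serves twice: it shows that a minimal sublinear functional is odd, hence linear, and,
  applied to the norm, it forces a linear functional below it to be nonzero at \<open>e\<close>.\<close>
definition tilt :: "('a::real_vector \<Rightarrow> real) \<Rightarrow> 'a \<Rightarrow> 'a \<Rightarrow> real" where
  "tilt q e x = (INF t\<in>{0..}. q (x + t *\<^sub>R e) - t * q e)"

lemma tilt_bdd:
  assumes "sublinear q" "0 \<le> t"
  shows "- q (- x) \<le> q (x + t *\<^sub>R e) - t * q e"
proof -
  have "t * q e = q ((x + t *\<^sub>R e) + - x)" using assms by (simp add: sublinear_def)
  also have "\<dots> \<le> q (x + t *\<^sub>R e) + q (- x)" using assms(1) unfolding sublinear_def by blast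
  finally show ?thesis by linarith
qed

lemma tilt_le:
  assumes "sublinear q" "0 \<le> t"
  shows "tilt q e x \<le> q (x + t *\<^sub>R e) - t * q e"
  unfolding tilt_def
  by (rule cINF_lower) (use assms tilt_bdd[OF assms(1)] in \<open>auto intro!: bdd_belowI2\<close>)

lemma tilt_greatest:
  assumes "\<And>t. 0 \<le> t \<Longrightarrow> m \<le> q (x + t *\<^sub>R e) - t * q e"
  shows "m \<le> tilt q e x"
  unfolding tilt_def by (rule cINF_greatest) (use assms in auto)

lemma sublinear_tilt:
  assumes q: "sublinear q"
  shows "sublinear (tilt q e)"
proof -
  have add: "tilt q e (x + y) \<le> tilt q e x + tilt q e y" for x y
  proof -
    have 1: "tilt q e (x + y) \<le> (q (x + s *\<^sub>R e) - s * q e) + (q (y + t *\<^sub>R e) - t * q e)"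
      if "0 \<le> s" "0 \<le> t" for s t
    proof -
      have "tilt q e (x + y) \<le> q ((x + y) + (s + t) *\<^sub>R e) - (s + t) * q e"
        using tilt_le[OF q, of "s + t" e "x + y"] that by simp
      also have "(x + y) + (s + t) *\<^sub>R e = (x + s *\<^sub>R e) + (y + t *\<^sub>R e)"
        by (simp add: algebra_simps)
      also have "q \<dots> \<le> q (x + s *\<^sub>R e) + q (y + t *\<^sub>R e)"
        using q unfolding sublinear_def by blast
      finally show ?thesis by (simp add: algebra_simps)
    qed
    have "tilt q e (x + y) - (q (x + s *\<^sub>R e) - s * q e) \<le> tilt q e y" if "0 \<le> s" for s
      by (rule tilt_greatest) (use 1 that in \<open>fastforce simp: algebra_simps\<close>)
    then have "tilt q e (x + y) - tilt q e y \<le> tilt q e x"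
      by (intro tilt_greatest) (simp add: algebra_simps)
    then show ?thesis by linarith
  qed
  have le: "r * tilt q e x \<le> tilt q e (r *\<^sub>R x)" if "0 < r" for r x
  proof (rule tilt_greatest)
    fix t :: real assume "0 \<le> t"
    then have "r * tilt q e x \<le> r * (q (x + (t / r) *\<^sub>R e) - (t / r) * q e)"
      using that tilt_le[OF q, of "t / r" e x] by (intro mult_left_mono) auto
    also have "\<dots> = q (r *\<^sub>R (x + (t / r) *\<^sub>R e)) - t * q e"
    proof -
      have "q (r *\<^sub>R (x + (t / r) *\<^sub>R e)) = r * q (x + (t / r) *\<^sub>R e)"
        using q that unfolding sublinear_def by (meson less_imp_le)
      then show ?thesis using that by (simp add: right_diff_distrib)
    qed
    also have "r *\<^sub>R (x + (t / r) *\<^sub>R e) = r *\<^sub>R x + t *\<^sub>R e"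
      using that by (simp add: algebra_simps)
    finally show "r * tilt q e x \<le> q (r *\<^sub>R x + t *\<^sub>R e) - t * q e" .
  qed
  have pos: "tilt q e (r *\<^sub>R x) = r * tilt q e x" if "0 < r" for r x
  proof (rule antisym)
    have "inverse r * tilt q e (r *\<^sub>R x) \<le> tilt q e x"
      using le[of "inverse r" "r *\<^sub>R x"] that by simp
    then show "tilt q e (r *\<^sub>R x) \<le> r * tilt q e x"
      using that by (simp add: field_simps)
  qed (use le that in auto)
  have zero: "tilt q e 0 = 0"
  proof (rule antisym)
    show "tilt q e 0 \<le> 0" using tilt_le[OF q, of 0 e 0] sublinear_zero[OF q] by simp
    show "0 \<le> tilt q e 0"
      by (rule tilt_greatest) (use q in \<open>simp add: sublinear_def\<close>)
  qed
  show ?thesis unfolding sublinear_def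
  proof (intro conjI allI impI add)
    fix r :: real and x assume "0 \<le> r"
    then show "tilt q e (r *\<^sub>R x) = r * tilt q e x"
      using pos zero by (cases "r = 0") auto
  qed
qed

lemma tilt_le_self: "sublinear q \<Longrightarrow> tilt q e x \<le> q x"
  using tilt_le[of q 0 e x] by simp

lemma tilt_neg: "sublinear q \<Longrightarrow> tilt q e (- e) \<le> - q e"
  using tilt_le[of q 1 e "- e"] sublinear_zero[of q] by simp

text \<open>By Zorn's lemma there is a minimal sublinear functional \<open>q\<close> below \<open>p\<close>; chains have sublinear
  infima because \<open>q (x)\<close> is bounded below by \<open>- p (- x)\<close>. Minimality gives \<open>tilt q e = q\<close> for
  every \<open>e\<close>, thus \<open>q (- e) = - q e\<close>, and an odd sublinear functional is linear.\<close>
lemma ex_linear_below_sublinear: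
  assumes p: "sublinear p"
  shows "\<exists>q. linear q \<and> (\<forall>x. q x \<le> p x)"
proof -
  define A where "A = {q. sublinear q \<and> (\<forall>x. q x \<le> p x)}"
  define P where "P = (\<lambda>f g :: 'a \<Rightarrow> real. g \<le> f)"
  have "\<exists>m\<in>A. \<forall>a\<in>A. P m a \<longrightarrow> a = m"
  proof (rule predicate_Zorn)
    show "partial_order_on A (relation_of P A)"
      by (rule partial_order_on_relation_ofI) (auto simp: P_def)
    fix C assume C: "C \<in> Chains (relation_of P A)"
    show "\<exists>u\<in>A. \<forall>a\<in>C. P a u"
    proof (cases "C = {}")
      case True
      then show ?thesis using p by (auto simp: A_def)
    next
      case False
      have CA: "q \<in> A" if "q \<in> C" for q using C that by (auto simp: Chains_def relation_of_def)
      have tot: "f \<le> g \<or> g \<le> f" if "f \<in> C" "g \<in> C" for f g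
        using C that by (auto simp: Chains_def relation_of_def P_def)
      define u where "u x = (INF q\<in>C. q x)" for x
      have low: "- p (- x) \<le> q x" if "q \<in> C" for q x
      proof -
        have "sublinear q" "q (- x) \<le> p (- x)" using CA[OF that] by (auto simp: A_def)
        then show ?thesis using sublinear_ge[of q x] by linarith
      qed
      have ule: "u x \<le> q x" if "q \<in> C" for q x
        unfolding u_def by (rule cINF_lower) (use low that in \<open>auto intro!: bdd_belowI2\<close>)
      have ugr: "m \<le> u x" if "\<And>q. q \<in> C \<Longrightarrow> m \<le> q x" for m x
        unfolding u_def by (rule cINF_greatest) (use False that in auto)
      have add: "u (x + y) \<le> u x + u y" for x y
      proof -
        have 1: "u (x + y) \<le> f x + g y" if fg: "f \<in> C" "g \<in> C" for f g
        proof -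
          obtain h where h: "h \<in> C" "h \<le> f" "h \<le> g" using tot[OF fg] fg by (meson order_refl)
          have "u (x + y) \<le> h (x + y)" by (rule ule[OF h(1)])
          also have "\<dots> \<le> h x + h y" using CA[OF h(1)] by (auto simp: A_def sublinear_def)
          also have "\<dots> \<le> f x + g y" using h by (intro add_mono) (auto simp: le_fun_def)
          finally show ?thesis .
        qed
        have "u (x + y) - f x \<le> u y" if "f \<in> C" for f
          by (rule ugr) (use 1[OF that] in \<open>simp add: algebra_simps\<close>)
        then have "u (x + y) - u y \<le> u x"
          by (intro ugr) (simp add: algebra_simps)
        then show ?thesis by linarith
      qed
      have scl: "q (r *\<^sub>R x) = r * q x" if "q \<in> C" "0 \<le> r" for q r x
        using CA[OF that(1)] that(2) by (auto simp: A_def sublinear_def)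
      have ge: "r * u x \<le> u (r *\<^sub>R x)" if "0 \<le> r" for r x
        by (rule ugr) (simp add: scl ule that mult_left_mono)
      have "u (r *\<^sub>R x) = r * u x" if "0 \<le> r" for r x
      proof (cases "r = 0")
        case True
        then have "u (r *\<^sub>R x) = (INF q\<in>C. 0 :: real)"
          unfolding u_def using scl[of _ 0 x] by (intro INF_cong) auto
        then show ?thesis using True \<open>C \<noteq> {}\<close> by simp
      next
        case False
        then have "inverse r * u (r *\<^sub>R x) \<le> u x"
          using ge[of "inverse r" "r *\<^sub>R x"] that by simp
        then have "u (r *\<^sub>R x) \<le> r * u x"
          using that False by (simp add: field_simps)
        then show ?thesis using ge[OF that] by (simp add: antisym)
      qed
      with add have "sublinear u" by (simp add: sublinear_def)
      moreover have "u x \<le> p x" for x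
      proof -
        obtain q where "q \<in> C" using False by blast
        then show ?thesis using ule[of q x] CA[of q] by (auto simp: A_def intro: order_trans)
      qed
      ultimately show ?thesis using ule by (intro bexI[of _ u]) (auto simp: A_def P_def le_fun_def)
    qed
  qed
  then obtain q where q: "sublinear q" "\<And>x. q x \<le> p x"
    and min: "\<And>a. sublinear a \<Longrightarrow> (\<And>x. a x \<le> p x) \<Longrightarrow> (\<And>x. a x \<le> q x) \<Longrightarrow> a = q"
    unfolding A_def P_def le_fun_def by blast
  have odd: "q (- e) = - q e" for e
  proof -
    have "tilt q e = q"
      using order_trans[OF tilt_le_self[OF q(1)] q(2)]
      by (intro min sublinear_tilt tilt_le_self q(1)) auto
    then have "q (- e) \<le> - q e" using tilt_neg[OF q(1), of e] by simp
    moreover have "- q e \<le> q (- e)" using sublinear_ge[OF q(1), of "- e"] by simp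
    ultimately show ?thesis by simp
  qed
  have sub: "q (x + y) \<le> q x + q y" for x y using q(1) by (simp add: sublinear_def)
  have pos: "q (r *\<^sub>R x) = r * q x" if "0 \<le> r" for r x using q(1) that by (simp add: sublinear_def)
  have "linear q"
  proof (rule linearI)
    show "q (x + y) = q x + q y" for x y
      using sub[of x y] sub[of "x + y" "- y"] odd[of y] by simp
    show "q (r *\<^sub>R x) = r *\<^sub>R q x" for r x
    proof (cases "0 \<le> r")
      case True then show ?thesis by (simp add: pos)
    next
      case False
      then have "q (r *\<^sub>R x) = - q ((- r) *\<^sub>R x)" using odd[of "r *\<^sub>R x"] by simp
      then show ?thesis using False pos[of "- r" x] by simp
    qed
  qed
  with q(2) show ?thesis by blast
qed

text \<open>A real-linear functional below \<open>tilt norm e\<close> is bounded by the norm and at least \<open>norm e\<close> at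
  \<open>e\<close>. It is the real part of a complex-linear one.\<close>
lemma ex_bounded_functional:
  fixes e :: "'a::complex_normed_vector"
  assumes "e \<noteq> 0"
  obtains f :: "'a \<Rightarrow> complex" where "bounded_linear f" "\<And>a x. f (a *\<^sub>C x) = a * f x" "f e = 1"
proof -
  have nrm: "sublinear (norm :: 'a \<Rightarrow> real)" by (simp add: sublinear_def norm_triangle_ineq)
  obtain q where q: "linear q" and le: "\<And>x. q x \<le> tilt norm e x"
    using ex_linear_below_sublinear[OF sublinear_tilt[OF nrm]] by blast
  have ub: "q x \<le> norm x" for x using le[of x] tilt_le_self[OF nrm, of e x] by linarith
  have abs: "\<bar>q x\<bar> \<le> norm x" for x
    using ub[of x] ub[of "- x"] linear_neg[OF q, of x] by simp
  have "norm e \<le> q e" using le[of "- e"] tilt_neg[OF nrm, of e] linear_neg[OF q, of e] by simp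
  then have qe: "q e \<noteq> 0" using assms by auto
  define g where "g x = Complex (q x) (- q (\<i> *\<^sub>C x))" for x
  have sc: "r *\<^sub>R x = complex_of_real r *\<^sub>C x" for r and x :: 'a by (simp add: scaleC_of_real)
  have g_add: "g (x + y) = g x + g y" for x y
    by (simp add: g_def linear_add[OF q] scaleC_add_right complex_eq_iff)
  have g_real: "g (of_real r *\<^sub>C x) = of_real r * g x" for r x
  proof -
    have "\<i> *\<^sub>C (of_real r *\<^sub>C x) = r *\<^sub>R (\<i> *\<^sub>C x)"
      by (simp add: sc scaleC_scaleC mult.commute)
    then have "q (\<i> *\<^sub>C (of_real r *\<^sub>C x)) = r * q (\<i> *\<^sub>C x)"
      using linear_cmul[OF q, of r "\<i> *\<^sub>C x"] by simp
    then show ?thesis using linear_cmul[OF q, of r x] by (simp add: g_def complex_eq_iff sc)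
  qed
  have g_i: "g (\<i> *\<^sub>C x) = \<i> * g x" for x
  proof -
    have "\<i> *\<^sub>C (\<i> *\<^sub>C x) = - x"
      using scaleC_of_real[of "- 1" x] by (simp add: scaleC_scaleC)
    then show ?thesis using linear_neg[OF q, of x] by (simp add: g_def complex_eq_iff)
  qed
  have g_scale: "g (a *\<^sub>C x) = a * g x" for a x
  proof -
    have "a = of_real (Re a) + of_real (Im a) * \<i>" by (simp add: complex_eq_iff)
    then have "g (a *\<^sub>C x) = g (of_real (Re a) *\<^sub>C x + of_real (Im a) *\<^sub>C (\<i> *\<^sub>C x))"
      by (metis scaleC_add_left scaleC_scaleC)
    also have "\<dots> = (of_real (Re a) + of_real (Im a) * \<i>) * g x"
      unfolding g_add g_real g_i by (simp add: distrib_right mult.assoc)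
    also have "\<dots> = a * g x" by (simp add: complex_eq_iff)
    finally show ?thesis .
  qed
  have g_le: "norm (g x) \<le> norm x * 2" for x
  proof -
    have "norm (g x) \<le> \<bar>Re (g x)\<bar> + \<bar>Im (g x)\<bar>" by (rule cmod_le)
    also have "\<dots> \<le> norm x + norm (\<i> *\<^sub>C x)" using abs[of x] abs[of "\<i> *\<^sub>C x"] by (simp add: g_def)
    finally show ?thesis by (simp add: norm_scaleC)
  qed
  have bl: "bounded_linear g"
    by (rule bounded_linear_intro[where K = 2])
      (use g_add g_le g_scale in \<open>auto simp: sc scaleR_conv_of_real\<close>)
  have ge: "g e \<noteq> 0" using qe by (simp add: g_def complex_eq_iff)
  show thesis
  proof (rule that)
    show "bounded_linear (\<lambda>x. inverse (g e) * g x)"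
      by (rule bounded_linear_const_mult[OF bl])
  qed (use ge g_scale in \<open>auto simp: algebra_simps\<close>)
qed

section \<open>Open mapping\<close>

text \<open>The range, being complete, is not a countable union of nowhere dense sets; so the closure of
  the image of some ball contains a ball of the range. Every point of the range is then
  approximated, up to half of its norm, by the image of a vector of comparable norm, and summing the
  successive corrections gives an exact preimage.\<close>
lemma open_mapping_closed_range:
  fixes f :: "'a::banach \<Rightarrow> 'b::banach"
  assumes f: "bounded_linear f" and cl: "closed (range f)"
  obtains K where "0 < K" "\<And>y. y \<in> range f \<Longrightarrow> \<exists>x. f x = y \<and> norm x \<le> K * norm y"
proof -
  interpret f: bounded_linear f by fact
  define Y where "Y = range f"
  have Yadd: "a + b \<in> Y" "a - b \<in> Y" if "a \<in> Y" "b \<in> Y" for a b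
    using that unfolding Y_def by (auto simp flip: f.add f.diff)
  have Yscale: "r *\<^sub>R a \<in> Y" if "a \<in> Y" for a r
    using that unfolding Y_def by (auto simp flip: f.scaleR)
  define D where "D n = closure (f ` cball 0 (real n))" for n
  have DY: "D n \<subseteq> Y" for n unfolding D_def Y_def using cl by (intro closure_minimal) auto
  have "\<exists>n. (top_of_set Y) interior_of (D n) \<noteq> {}"
  proof (rule ccontr)
    assume neg: "\<nexists>n. (top_of_set Y) interior_of (D n) \<noteq> {}"
    have cm: "completely_metrizable_space (top_of_set Y)"
      by (intro completely_metrizable_space_closedin completely_metrizable_space_euclidean)
         (use cl in \<open>simp add: Y_def\<close>)
    have "(top_of_set Y) interior_of (\<Union>(range D)) = {}"
    proof (rule Baire_category_alt)
      fix U assume "U \<in> range D"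
      then obtain n where "U = D n" by blast
      moreover have "closedin (top_of_set Y) (D n)"
        by (rule closed_subset[OF DY]) (simp add: D_def)
      ultimately show "closedin (top_of_set Y) U \<and> (top_of_set Y) interior_of U = {}"
        using neg by simp
    qed (use cm in auto)
    moreover have "\<Union>(range D) = Y"
    proof (rule antisym)
      show "Y \<subseteq> \<Union>(range D)"
      proof
        fix y assume "y \<in> Y"
        then obtain x where x: "y = f x" by (auto simp: Y_def)
        obtain n where "norm x \<le> real n" using real_arch_simple by blast
        then have "y \<in> D n" unfolding D_def x by (intro closure_subset[THEN subsetD]) auto
        then show "y \<in> \<Union>(range D)" by blast
      qed
    qed (use DY in blast)
    ultimately have "Y = {}" using interior_of_topspace[of "top_of_set Y"] by simp
    then show False by (simp add: Y_def)
  qed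
  then obtain n y0 where "y0 \<in> (top_of_set Y) interior_of (D n)" by blast
  then obtain V where V: "openin (top_of_set Y) V" "y0 \<in> V" "V \<subseteq> D n"
    by (auto simp: interior_of_def)
  then obtain r where r: "0 < r" "ball y0 r \<inter> Y \<subseteq> D n"
    unfolding openin_contains_ball by blast
  have y0: "y0 \<in> Y" using V DY by blast
  \<comment> \<open>Writing \<open>y\<close> as \<open>(y0 + y) - y0\<close> moves the ball to the origin and doubles the radius in the
    domain.\<close>
  have near: "\<exists>x. norm x \<le> 2 * real n \<and> norm (y - f x) < \<epsilon>" if y: "y \<in> Y" "norm y < r" and "0 < \<epsilon>" for y \<epsilon>
  proof -
    have "y0 + y \<in> D n" "y0 \<in> D n"
      using r y y0 Yadd by (auto simp: dist_norm subset_iff)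
    then obtain a b where ab: "norm a \<le> real n" "dist (f a) (y0 + y) < \<epsilon> / 2"
      "norm b \<le> real n" "dist (f b) y0 < \<epsilon> / 2"
    proof -
      have "\<exists>a\<in>cball 0 (real n). dist (f a) w < \<epsilon> / 2" if "w \<in> D n" for w
        using that \<open>0 < \<epsilon>\<close> half_gt_zero[of \<epsilon>] unfolding D_def closure_approachable by blast
      then show ?thesis using that \<open>y0 + y \<in> D n\<close> \<open>y0 \<in> D n\<close> by (metis mem_cball_0)
    qed
    have "norm (y - f (a - b)) = norm (((y0 + y) - f a) - (y0 - f b))"
      by (simp add: f.diff algebra_simps)
    also have "\<dots> \<le> norm ((y0 + y) - f a) + norm (y0 - f b)" by (rule norm_triangle_ineq4)
    also have "\<dots> < \<epsilon>" using ab by (simp add: dist_norm norm_minus_commute)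
    finally have "norm (y - f (a - b)) < \<epsilon>" .
    moreover have "norm (a - b) \<le> 2 * real n" using ab norm_triangle_ineq4[of a b] by linarith
    ultimately show ?thesis by blast
  qed
  \<comment> \<open>The \<open>1\<close> only makes \<open>K\<close> positive when \<open>n = 0\<close>.\<close>
  define K where "K = 4 * real n / r + 1"
  have K: "0 < K" using r by (simp add: K_def add_nonneg_pos)
  have half: "\<exists>x. norm x \<le> K * norm y \<and> norm (y - f x) \<le> norm y / 2" if y: "y \<in> Y" for y
  proof (cases "y = 0")
    case True then show ?thesis by (intro exI[of _ 0]) (simp add: f.zero)
  next
    case False
    define s where "s = r / (2 * norm y)"
    have s: "0 < s" using r False by (simp add: s_def)
    have sy: "norm (s *\<^sub>R y) < r" using r False by (simp add: s_def)
    obtain x where x: "norm x \<le> 2 * real n" "norm (s *\<^sub>R y - f x) < s * norm y / 2"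
      using near[OF Yscale[OF y] sy, of "s * norm y / 2"] s False by auto
    have "s *\<^sub>R y - f x = s *\<^sub>R (y - f (inverse s *\<^sub>R x))"
      using s by (simp add: f.scaleR scaleR_diff_right)
    then have "s * norm (y - f (inverse s *\<^sub>R x)) < s * (norm y / 2)" using x(2) s by simp
    then have "norm (y - f (inverse s *\<^sub>R x)) \<le> norm y / 2" using s by simp
    moreover have "norm (inverse s *\<^sub>R x) \<le> K * norm y"
    proof -
      have "norm (inverse s *\<^sub>R x) \<le> inverse s * (2 * real n)"
        using x(1) s by (simp add: mult_left_mono)
      also have "\<dots> = 4 * real n / r * norm y" by (simp add: s_def field_simps)
      also have "\<dots> \<le> K * norm y" by (simp add: K_def distrib_right)
      finally show ?thesis .
    qed
    ultimately show ?thesis by blast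
  qed
  then obtain g where g: "\<And>y. y \<in> Y \<Longrightarrow> norm (g y) \<le> K * norm y"
    "\<And>y. y \<in> Y \<Longrightarrow> norm (y - f (g y)) \<le> norm y / 2"
    by metis
  show thesis
  proof (rule that[of "2 * K"])
    show "0 < 2 * K" using K by simp
    fix y assume "y \<in> range f"
    then have y: "y \<in> Y" by (simp add: Y_def)
    define z where "z = rec_nat y (\<lambda>_ w. w - f (g w))"
    have z0: "z 0 = y" and zS: "z (Suc k) = z k - f (g (z k))" for k by (simp_all add: z_def)
    have zY: "z k \<in> Y" for k
      by (induction k) (use y Yadd in \<open>auto simp: z0 zS Y_def\<close>)
    have zn: "norm (z k) \<le> norm y * (1/2) ^ k" for k
    proof (induction k)
      case (Suc k)
      then show ?case using g(2)[OF zY, of k] by (simp add: zS)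
    qed (simp add: z0)
    have xn: "norm (g (z k)) \<le> K * norm y * (1/2) ^ k" for k
      using order_trans[OF g(1)[OF zY, of k] mult_left_mono[OF zn[of k] less_imp_le[OF K]]]
      by (simp add: mult.assoc)
    have geo: "(\<lambda>k. K * norm y * (1/2) ^ k) sums (K * norm y * 2)"
      using geometric_sums[of "1/2::real"] by (intro sums_mult) simp
    have sm: "summable (\<lambda>k. g (z k))"
      by (rule summable_comparison_test'[OF sums_summable[OF geo], of 0]) (use xn in auto)
    define x where "x = (\<Sum>k. g (z k))"
    have "norm x \<le> K * norm y * 2"
      using suminf_le[of "\<lambda>k. norm (g (z k))" "\<lambda>k. K * norm y * (1/2) ^ k"] xn geo
        summable_norm[of "\<lambda>k. g (z k)"]
        summable_comparison_test'[OF sums_summable[OF geo], of 0 "\<lambda>k. norm (g (z k))"]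
      by (auto simp: x_def sums_unique[OF geo, symmetric] intro: order_trans)
    moreover have "f x = y"
    proof -
      have "(\<lambda>k. f (g (z k))) sums f x"
        unfolding x_def by (intro f.sums summable_sums sm)
      moreover have "(\<lambda>k. f (g (z k))) sums (y - 0)"
      proof -
        have "z \<longlonglongrightarrow> 0"
        proof (rule Lim_null_comparison)
          show "(\<lambda>k. norm y * (1/2) ^ k) \<longlonglongrightarrow> 0"
            by (intro tendsto_mult_right_zero LIMSEQ_realpow_zero) auto
        qed (use zn in auto)
        then have "(\<lambda>k. z k - z (Suc k)) sums (z 0 - 0)" by (rule telescope_sums')
        then show ?thesis by (simp add: zS z0)
      qed
      ultimately show ?thesis using sums_unique2 by force
    qed
    ultimately show "\<exists>x. f x = y \<and> norm x \<le> 2 * K * norm y" by (intro exI[of _ x]) (simp add: algebra_simps)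
  qed
qed

section \<open>Operators bounded below\<close>

definition bounded_below :: "('a::real_normed_vector \<Rightarrow> 'b::real_normed_vector) \<Rightarrow> bool" where
  "bounded_below f \<longleftrightarrow> (\<exists>c>0. \<forall>x. c * norm x \<le> norm (f x))"

lemma bounded_clinear_add:
  "bounded_clinear f \<Longrightarrow> bounded_clinear g \<Longrightarrow> bounded_clinear (\<lambda>x. f x + g x)"
  unfolding bounded_clinear_def by (simp add: bounded_linear_add scaleC_add_right)

lemma bounded_clinear_scaleC: "bounded_clinear (\<lambda>x. a *\<^sub>C x)"
  unfolding bounded_clinear_def
proof (intro conjI allI)
  show "bounded_linear (\<lambda>x::'a. a *\<^sub>C x)"
    by (rule bounded_linear_intro[where K = "cmod a"])
      (simp_all add: scaleC_add_right norm_scaleC scaleC_scaleC mult.commute flip: scaleC_of_real)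
qed (simp add: scaleC_scaleC mult.commute)

lemma bounded_clinear_op_shift:
  assumes "bounded_clinear T" shows "bounded_clinear (op_shift T l)"
  using bounded_clinear_add[OF assms bounded_clinear_scaleC[of "- l"]] by (simp add: op_shift_def)

lemma bounded_clinear_imp_linear: "bounded_clinear f \<Longrightarrow> Vector_Spaces.linear scaleC scaleC f"
  unfolding bounded_clinear_def
  by unfold_locales (auto simp: linear_add bounded_linear.linear)

text \<open>The backward direction is the open mapping theorem for the map onto the range.\<close>
lemma bounded_below_iff_inj_closed_range:
  fixes f :: "'a::banach \<Rightarrow> 'b::banach"
  assumes f: "bounded_linear f"
  shows "bounded_below f \<longleftrightarrow> inj f \<and> closed (range f)"
proof
  assume "bounded_below f"
  then obtain c where c: "0 < c" "\<And>x. c * norm x \<le> norm (f x)" by (auto simp: bounded_below_def)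
  have "inj f"
    unfolding linear_injective_0[OF bounded_linear.linear[OF f]]
    using c by (metis mult_le_0_iff norm_le_zero_iff norm_zero not_less)
  moreover have "complete (range f)"
    by (rule complete_isometric_image[OF c(1) _ f]) (use c(2) in \<open>auto simp: complete_UNIV\<close>)
  ultimately show "inj f \<and> closed (range f)" by (simp add: complete_imp_closed)
next
  assume fi: "inj f \<and> closed (range f)"
  then obtain K where K: "0 < K" "\<And>y. y \<in> range f \<Longrightarrow> \<exists>x. f x = y \<and> norm x \<le> K * norm y"
    using open_mapping_closed_range[OF f] by metis
  have "inverse K * norm x \<le> norm (f x)" for x
    using K(2)[of "f x"] fi K(1) by (auto simp: inj_eq field_simps)
  then show "bounded_below f" unfolding bounded_below_def using K(1) by (metis positive_imp_inverse_positive)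
qed

text \<open>With a right inverse \<open>g\<close> of \<open>f\<close>, the equation \<open>f x + a *\<^sub>C x = y\<close> asks for a fixed point of
  \<open>\<lambda>x. g (y - a *\<^sub>C x)\<close>, which contracts by the factor \<open>cmod a / c\<close>.\<close>
lemma surj_perturbation:
  fixes f :: "'a::cbanach \<Rightarrow> 'a"
  assumes f: "bounded_clinear f" "surj f" and c: "0 < c" "\<And>x. c * norm x \<le> norm (f x)"
    and a: "cmod a < c"
  shows "surj (\<lambda>x. f x + a *\<^sub>C x)"
  unfolding surj_def
proof
  fix y
  interpret bounded_linear f using f by (simp add: bounded_clinear_def)
  obtain g where g: "\<And>z. f (g z) = z" using f(2) by (metis surj_def)
  have "\<exists>!x. g (y - a *\<^sub>C x) = x"
  proof (rule banach_fix_type[of "cmod a / c"])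
    show "\<forall>u v. dist (g (y - a *\<^sub>C u)) (g (y - a *\<^sub>C v)) \<le> cmod a / c * dist u v"
    proof (intro allI)
      fix u v
      have "c * norm (g (y - a *\<^sub>C u) - g (y - a *\<^sub>C v)) \<le> norm (f (g (y - a *\<^sub>C u) - g (y - a *\<^sub>C v)))"
        by (rule c)
      also have "\<dots> = norm (a *\<^sub>C (v - u))"
        by (simp add: diff g complex_vector.scale_right_diff_distrib)
      also have "\<dots> = cmod a * norm (u - v)" by (simp add: norm_scaleC norm_minus_commute)
      finally show "dist (g (y - a *\<^sub>C u)) (g (y - a *\<^sub>C v)) \<le> cmod a / c * dist u v"
        using c(1) by (simp add: dist_norm field_simps)
    qed
  qed (use c a in auto)
  then obtain x where "g (y - a *\<^sub>C x) = x" by blast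
  then have "f x = y - a *\<^sub>C x" by (metis g)
  then show "\<exists>x. y = f x + a *\<^sub>C x" by (intro exI[of _ x]) simp
qed

lemma bounded_below_perturbation:
  fixes f :: "'a::complex_normed_vector \<Rightarrow> 'a"
  assumes "\<And>x. c * norm x \<le> norm (f x)"
  shows "(c - cmod a) * norm x \<le> norm (f x + a *\<^sub>C x)"
  using assms[of x] norm_diff_ineq[of "f x" "a *\<^sub>C x"] by (simp add: norm_scaleC algebra_simps)

section \<open>Operators of finite rank\<close>

definition finite_rank :: "('a::complex_normed_vector \<Rightarrow> 'a) \<Rightarrow> bool" where
  "finite_rank F \<longleftrightarrow> bounded_clinear F \<and> (\<exists>B. finite B \<and> range F \<subseteq> complex_vector.span B)"

lemma finite_rank_zero: "finite_rank (\<lambda>x. 0)"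
  unfolding finite_rank_def bounded_clinear_def
  by (auto intro!: exI[of _ "{}"] bounded_linear_zero)

lemma finite_rank_add:
  assumes "finite_rank F" "finite_rank G"
  shows "finite_rank (\<lambda>x. F x + G x)"
proof -
  obtain B C where B: "finite B" "range F \<subseteq> complex_vector.span B"
    and C: "finite C" "range G \<subseteq> complex_vector.span C"
    using assms by (auto simp: finite_rank_def)
  have "F x + G x \<in> complex_vector.span (B \<union> C)" for x
    using B(2) C(2) complex_vector.span_mono[of B "B \<union> C"] complex_vector.span_mono[of C "B \<union> C"]
    by (intro complex_vector.span_add) blast+
  then have "range (\<lambda>x. F x + G x) \<subseteq> complex_vector.span (B \<union> C)" by blast
  moreover have "bounded_clinear (\<lambda>x. F x + G x)"
    using assms by (intro bounded_clinear_add) (simp_all add: finite_rank_def)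
  ultimately show ?thesis
    unfolding finite_rank_def using B(1) C(1) by (intro conjI exI[of _ "B \<union> C"]) simp_all
qed

lemma finite_rank_neg:
  assumes "finite_rank F" shows "finite_rank (\<lambda>x. - F x)"
proof -
  have "bounded_clinear (\<lambda>x. - F x)"
    using assms by (simp add: finite_rank_def bounded_clinear_def bounded_linear_minus)
  moreover have "range (\<lambda>x. - F x) \<subseteq> complex_vector.span B" if "range F \<subseteq> complex_vector.span B" for B
    using that by (auto intro!: complex_vector.span_neg)
  ultimately show ?thesis using assms unfolding finite_rank_def by blast
qed

text \<open>The operator \<open>I + H\<close> maps the finite-dimensional span \<open>V\<close> of \<open>B\<close> injectively into itself, hence
  onto itself, and it induces the identity modulo \<open>V\<close>.\<close>
lemma id_plus_finite_rank_inj_imp_surj: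
  fixes H :: "'a::complex_normed_vector \<Rightarrow> 'a"
  assumes H: "Vector_Spaces.linear scaleC scaleC H"
    and B: "finite B" "range H \<subseteq> complex_vector.span B"
    and inj: "inj (\<lambda>x. x + H x)"
  shows "surj (\<lambda>x. x + H x)"
proof -
  interpret H: Vector_Spaces.linear scaleC scaleC H by fact
  define L where "L = (\<lambda>x. x + H x)"
  have L: "Vector_Spaces.linear scaleC scaleC L"
    unfolding L_def by unfold_locales (auto simp: H.add H.scale scaleC_add_right)
  interpret L: Vector_Spaces.linear scaleC scaleC L by fact
  define V where "V = complex_vector.span B"
  obtain A where A: "A \<subseteq> V" "complex_vector.independent A" "V \<subseteq> complex_vector.span A"
    by (rule complex_vector.basis_exists)
  have finA: "finite A" using complex_vector.independent_span_bound[OF B(1) A(2)] A(1) V_def by blast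
  have spA: "complex_vector.span A = V"
    using A complex_vector.span_minimal[of A V] unfolding V_def by auto
  have LV: "L x \<in> V" if "x \<in> V" for x
    using that B(2) unfolding L_def V_def by (intro complex_vector.span_add) auto
  have injL: "inj L" using inj by (simp add: L_def)
  have ind: "complex_vector.independent (L ` A)"
    using L.independent_inj_on_image[OF A(2)] injL by (meson inj_on_subset subset_UNIV)
  have card: "card (L ` A) = card A" using injL by (meson card_image inj_on_subset subset_UNIV)
  have VL: "V \<subseteq> L ` V"
  proof
    fix v assume v: "v \<in> V"
    have "v \<in> complex_vector.span (L ` A)"
    proof (rule ccontr)
      assume nv: "v \<notin> complex_vector.span (L ` A)"
      then have "complex_vector.independent (insert v (L ` A))"
        using ind by (rule complex_vector.independent_insertI)
      moreover have "insert v (L ` A) \<subseteq> complex_vector.span A" using v LV A(1) spA by auto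
      ultimately have "card (insert v (L ` A)) \<le> card A"
        using complex_vector.independent_span_bound[OF finA] by blast
      moreover have "v \<notin> L ` A" using nv complex_vector.span_base by blast
      ultimately show False using finA card by simp
    qed
    then show "v \<in> L ` V" using L.span_image[of A] spA by simp
  qed
  show ?thesis
    unfolding surj_def
  proof
    fix y
    have "H y \<in> V" using B(2) V_def by blast
    then obtain v where "H y = v + H v" using VL L_def by blast
    then have "y = (y - v) + H (y - v)" by (simp add: H.diff algebra_simps)
    then show "\<exists>x. y = x + H x" by blast
  qed
qed

text \<open>A case of the Fredholm alternative, which reduces to a perturbation of the identity by
  \<open>G + F = G (I + G\<^sup>-\<^sup>1 F)\<close>.\<close>
lemma bij_plus_finite_rank_inj_imp_surj:
  fixes G :: "'a::complex_normed_vector \<Rightarrow> 'a"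
  assumes G: "bounded_clinear G" "bij G" and F: "finite_rank F"
    and inj: "inj (\<lambda>x. G x + F x)"
  shows "surj (\<lambda>x. G x + F x)"
proof -
  interpret G: Vector_Spaces.linear scaleC scaleC G using G(1) by (rule bounded_clinear_imp_linear)
  interpret F: Vector_Spaces.linear scaleC scaleC F
    using F by (simp add: finite_rank_def bounded_clinear_imp_linear)
  obtain B where B: "finite B" "range F \<subseteq> complex_vector.span B" using F by (auto simp: finite_rank_def)
  define g where "g = inv G"
  have Gg: "G (g x) = x" and gG: "g (G x) = x" for x
    using G(2) by (simp_all add: g_def bij_is_surj surj_f_inv_f bij_is_inj)
  interpret g: Vector_Spaces.linear scaleC scaleC g
    by unfold_locales (metis G.add Gg gG, metis G.scale Gg gG)
  have "surj (\<lambda>x. x + (g \<circ> F) x)"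
  proof (rule id_plus_finite_rank_inj_imp_surj)
    show "Vector_Spaces.linear scaleC scaleC (g \<circ> F)"
      by unfold_locales (simp_all add: F.add g.add F.scale g.scale)
    show "finite (g ` B)" using B by simp
    show "range (g \<circ> F) \<subseteq> complex_vector.span (g ` B)"
      using B(2) g.span_image[of B] by auto
    show "inj (\<lambda>x. x + (g \<circ> F) x)"
      using inj unfolding inj_def by (metis G.add Gg comp_apply)
  qed
  then show ?thesis unfolding surj_def by (metis G.add Gg comp_apply)
qed

section \<open>Removing the kernel\<close>

text \<open>If \<open>d\<close> is a positive lower bound for the distance of \<open>c\<close> from \<open>M\<close>, then
  \<open>cmod a * d \<le> norm (r + a *\<^sub>C c)\<close>, so along a convergent sequence the coefficients of \<open>c\<close> are
  Cauchy and the components in \<open>M\<close> converge as well.\<close>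
lemma closed_add_line:
  fixes M :: "'a::complex_normed_vector set"
  assumes M: "closed M" "complex_vector.subspace M" and c: "c \<notin> M"
  shows "closed {r + a *\<^sub>C c | r a. r \<in> M}"
proof -
  obtain d where d: "0 < d" "ball c d \<inter> M = {}"
    using M(1) c by (metis open_Compl ComplI open_contains_ball disjoint_eq_subset_Compl)
  have low: "cmod a * d \<le> norm (r + a *\<^sub>C c)" if "r \<in> M" for r a
  proof (cases "a = 0")
    case False
    define m where "m = (- inverse a) *\<^sub>C r"
    have "m \<in> M" using that M(2) by (simp add: m_def complex_vector.subspace_scale del: complex_vector.scale_minus_left)
    then have "d \<le> norm (c - m)" using d(2) by (auto simp: dist_norm disjoint_iff not_less)
    then have "cmod a * d \<le> norm (a *\<^sub>C (c - m))" by (simp add: norm_scaleC mult_left_mono)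
    also have "a *\<^sub>C (c - m) = r + a *\<^sub>C c"
      using False by (simp add: m_def complex_vector.scale_right_diff_distrib scaleC_add_right scaleC_scaleC add.commute)
    finally show ?thesis .
  qed simp
  show ?thesis
    unfolding closed_sequential_limits
  proof (intro allI impI)
    fix s y assume "(\<forall>n. s n \<in> {r + a *\<^sub>C c | r a. r \<in> M}) \<and> s \<longlonglongrightarrow> y"
    then have ex: "\<forall>n. \<exists>r a. s n = r + a *\<^sub>C c \<and> r \<in> M" and lim: "s \<longlonglongrightarrow> y" by blast+
    obtain r a where s: "\<And>n. s n = r n + a n *\<^sub>C c" and r: "\<And>n. r n \<in> M"
      using ex by metis
    have "Cauchy a"
    proof (rule metric_CauchyI)
      fix \<epsilon> :: real assume "0 < \<epsilon>"
      then obtain N where N: "\<And>m n. N \<le> m \<Longrightarrow> N \<le> n \<Longrightarrow> dist (s m) (s n) < \<epsilon> * d"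
        using metric_CauchyD[OF LIMSEQ_imp_Cauchy[OF lim], of "\<epsilon> * d"] d(1) by auto
      have "dist (a m) (a n) < \<epsilon>" if "N \<le> m" "N \<le> n" for m n
      proof -
        have "cmod (a m - a n) * d \<le> norm ((r m - r n) + (a m - a n) *\<^sub>C c)"
          using r M(2) by (intro low complex_vector.subspace_diff)
        also have "\<dots> = dist (s m) (s n)"
          by (simp add: s dist_norm complex_vector.scale_left_diff_distrib algebra_simps)
        also have "\<dots> < \<epsilon> * d" using N that by blast
        finally show ?thesis using d(1) by (simp add: dist_norm)
      qed
      then show "\<exists>N. \<forall>m\<ge>N. \<forall>n\<ge>N. dist (a m) (a n) < \<epsilon>" by blast
    qed
    then obtain b where b: "a \<longlonglongrightarrow> b" using convergent_eq_Cauchy by blast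
    have "(\<lambda>n. a n *\<^sub>C c) \<longlonglongrightarrow> b *\<^sub>C c"
    proof -
      have "(\<lambda>n. cmod (a n - b) * norm c) \<longlonglongrightarrow> 0"
        using b by (simp add: LIM_zero tendsto_mult_left_zero tendsto_norm_zero)
      moreover have "cmod (a n - b) * norm c = norm (a n *\<^sub>C c - b *\<^sub>C c)" for n
        by (simp add: norm_scaleC flip: complex_vector.scale_left_diff_distrib)
      ultimately have "(\<lambda>n. norm (a n *\<^sub>C c - b *\<^sub>C c)) \<longlonglongrightarrow> 0" by simp
      then show ?thesis by (metis LIM_zero_cancel tendsto_norm_zero_cancel)
    qed
    with lim have "(\<lambda>n. s n - a n *\<^sub>C c) \<longlonglongrightarrow> y - b *\<^sub>C c" by (rule tendsto_diff)
    then have "r \<longlonglongrightarrow> y - b *\<^sub>C c" by (simp add: s)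
    then have "y - b *\<^sub>C c \<in> M" using M(1) r closed_sequentially by blast
    then show "y \<in> {r + a *\<^sub>C c | r a. r \<in> M}"
      by (intro CollectI exI[of _ "y - b *\<^sub>C c"] exI[of _ b]) simp
  qed
qed

lemma ccodim_le_iff:
  "ccodim M \<le> enat n \<longleftrightarrow> (\<exists>B. finite B \<and> card B \<le> n \<and> complex_vector.span (M \<union> B) = UNIV)"
proof -
  have "ccodim M \<le> enat n \<longleftrightarrow> ccodim M < enat (Suc n)"
    by (cases "ccodim M") auto
  also have "\<dots> \<longleftrightarrow> (\<exists>B. finite B \<and> card B \<le> n \<and> complex_vector.span (M \<union> B) = UNIV)"
    unfolding ccodim_def INF_less_iff by (auto simp: less_Suc_eq_le)
  finally show ?thesis .
qed

lemma ccodim_eq_0_iff: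
  assumes "complex_vector.subspace M" shows "ccodim M = 0 \<longleftrightarrow> M = UNIV"
proof -
  have "ccodim M = 0 \<longleftrightarrow> ccodim M \<le> enat 0" by (simp add: enat_0)
  also have "\<dots> \<longleftrightarrow> M = UNIV"
  proof
    assume "ccodim M \<le> enat 0"
    then have "complex_vector.span M = UNIV" unfolding ccodim_le_iff by auto
    then show "M = UNIV" using assms by (metis complex_vector.span_eq_iff)
  qed (auto simp: ccodim_le_iff intro!: exI[of _ "{}"])
  finally show ?thesis .
qed

text \<open>The Steinitz exchange step relative to \<open>M\<close>: the new vector can replace some element of \<open>B\<close>.\<close>
lemma span_Un_exchange:
  assumes "finite B" "c \<in> complex_vector.span (M \<union> B)" "c \<notin> complex_vector.span M"
  shows "\<exists>b\<in>B. b \<in> complex_vector.span (insert c (M \<union> (B - {b})))"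
  using assms
proof (induction B)
  case (insert b B)
  show ?case
  proof (cases "c \<in> complex_vector.span (M \<union> B)")
    case True
    then obtain b' where b': "b' \<in> B" "b' \<in> complex_vector.span (insert c (M \<union> (B - {b'})))"
      using insert by blast
    then show ?thesis
      using complex_vector.span_mono[of "insert c (M \<union> (B - {b'}))" "insert c (M \<union> (insert b B - {b'}))"]
      by blast
  next
    case False
    then have "b \<in> complex_vector.span (insert c (M \<union> B))"
      using complex_vector.in_span_insert[of c b "M \<union> B"] insert.prems by simp
    then show ?thesis using insert.hyps by simp
  qed
qed simp

lemma ccodim_add_line:
  fixes M :: "'a::complex_normed_vector set"
  assumes M: "complex_vector.subspace M" and c: "c \<notin> M"
  shows "ccodim M = ccodim {r + a *\<^sub>C c | r a. r \<in> M} + 1"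
proof -
  define M' where "M' = {r + a *\<^sub>C c | r a. r \<in> M}"
  have M': "M' = complex_vector.span (insert c M)"
  proof -
    have "complex_vector.span M = M" using M by (simp add: complex_vector.span_eq_iff)
    moreover have "(\<exists>r a. x = r + a *\<^sub>C c \<and> r \<in> M) \<longleftrightarrow> (\<exists>a. x - a *\<^sub>C c \<in> M)" for x
      by (metis add_diff_cancel_right' diff_add_cancel)
    ultimately show ?thesis unfolding M'_def complex_vector.span_insert by blast
  qed
  have spU: "complex_vector.span (M' \<union> B) = complex_vector.span (insert c M \<union> B)" for B
    unfolding M' complex_vector.span_Un by (simp add: complex_vector.span_span)
  have "ccodim M' \<le> enat n \<longleftrightarrow> ccodim M \<le> enat (Suc n)" for n
  proof
    assume "ccodim M' \<le> enat n"
    then obtain B where B: "finite B" "card B \<le> n" "complex_vector.span (M' \<union> B) = UNIV"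
      unfolding ccodim_le_iff by blast
    then have "complex_vector.span (M \<union> insert c B) = UNIV" by (simp add: spU)
    moreover have "card (insert c B) \<le> Suc n" using B by (simp add: card_insert_if)
    ultimately show "ccodim M \<le> enat (Suc n)" unfolding ccodim_le_iff using B(1) by blast
  next
    assume "ccodim M \<le> enat (Suc n)"
    then obtain B where B: "finite B" "card B \<le> Suc n" "complex_vector.span (M \<union> B) = UNIV"
      unfolding ccodim_le_iff by blast
    have "c \<notin> complex_vector.span M" using M c by (metis complex_vector.span_eq_iff)
    then obtain b where b: "b \<in> B" "b \<in> complex_vector.span (insert c (M \<union> (B - {b})))"
      using span_Un_exchange[OF B(1), of c M] B(3) by auto
    have "M \<union> B \<subseteq> complex_vector.span (insert c M \<union> (B - {b}))"
      using b by (auto intro: complex_vector.span_base)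
    then have "complex_vector.span (insert c M \<union> (B - {b})) = UNIV"
      using B(3) complex_vector.span_minimal[of "M \<union> B" "complex_vector.span (insert c M \<union> (B - {b}))"]
      by auto
    moreover have "card (B - {b}) \<le> n" using B b(1) by simp
    ultimately show "ccodim M' \<le> enat n" unfolding ccodim_le_iff spU using B(1) by blast
  qed
  moreover have "ccodim M \<noteq> 0" using ccodim_eq_0_iff[OF M] c by auto
  ultimately have eq: "ccodim M' \<le> enat n \<longleftrightarrow> ccodim M \<le> enat (Suc n)" and nz: "ccodim M \<noteq> 0" for n
    by blast+
  have "ccodim M = ccodim M' + 1"
  proof (cases "ccodim M")
    case (enat m)
    then obtain k where m: "m = Suc k" using nz by (cases m) (auto simp: zero_enat_def)
    have "ccodim M' \<le> enat k" using eq[of k] enat m by simp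
    then obtain j where j: "ccodim M' = enat j" "j \<le> k" by (cases "ccodim M'") auto
    then have "m \<le> Suc j" using eq[of j] enat by simp
    then show ?thesis using j m enat by (simp add: one_enat_def)
  next
    case infinity
    then have "\<not> ccodim M' \<le> enat n" for n using eq[of n] by simp
    then have "ccodim M' = \<infinity>" by (cases "ccodim M'") auto
    then show ?thesis using infinity by simp
  qed
  then show ?thesis by (simp add: M'_def)
qed

lemma cdim_kernel_functional:
  fixes f :: "'a::complex_normed_vector \<Rightarrow> complex"
  assumes N: "complex_vector.subspace N"
    and f: "\<And>x y. f (x + y) = f x + f y" "\<And>a x. f (a *\<^sub>C x) = a * f x"
    and e: "e \<in> N" "f e = 1"
  shows "cdim N = cdim {x \<in> N. f x = 0} + 1"
proof -
  define N0 where "N0 = {x \<in> N. f x = 0}"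
  have N0: "complex_vector.subspace N0"
  proof (rule complex_vector.subspaceI)
    show "0 \<in> N0" using N f(2)[of 0 0] by (simp add: N0_def complex_vector.subspace_0)
  qed (use N f in \<open>auto simp: N0_def complex_vector.subspace_add complex_vector.subspace_scale\<close>)
  have split: "N \<subseteq> complex_vector.span (insert e B)" if "N0 \<subseteq> complex_vector.span B" for B
  proof
    fix x assume x: "x \<in> N"
    have "f (x - f x *\<^sub>C e) = 0"
      using f(1)[of x "(- f x) *\<^sub>C e"] f(2)[of "- f x" e] e(2) by simp
    then have "x - f x *\<^sub>C e \<in> N0"
      using x e(1) N by (simp add: N0_def complex_vector.subspace_diff complex_vector.subspace_scale)
    then show "x \<in> complex_vector.span (insert e B)"
      using that by (auto simp: complex_vector.span_insert)
  qed
  show ?thesis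
  proof (cases "\<exists>B. finite B \<and> N \<subseteq> complex_vector.span B")
    case True
    then obtain B where B: "finite B" "N \<subseteq> complex_vector.span B" by blast
    have N0B: "N0 \<subseteq> complex_vector.span B" using B by (auto simp: N0_def)
    obtain A where A: "A \<subseteq> N0" "complex_vector.independent A" "N0 \<subseteq> complex_vector.span A"
      "card A = complex_vector.dim N0"
      by (rule complex_vector.basis_exists)
    have finA: "finite A"
      using complex_vector.independent_span_bound[OF B(1) A(2)] A(1) N0B by blast
    have "complex_vector.span A \<subseteq> N0" using A(1) N0 by (rule complex_vector.span_minimal)
    then have "e \<notin> complex_vector.span A" using e(2) by (auto simp: N0_def)
    then have "complex_vector.independent (insert e A)" and "e \<notin> A"
      using complex_vector.independent_insertI[OF _ A(2)] complex_vector.span_base[of e A] by blast+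
    then have "complex_vector.dim N = Suc (card A)"
      using finA A(1) e(1) split[OF A(3)]
      by (intro complex_vector.dim_unique[of "insert e A"]) (auto simp: N0_def)
    moreover have "cdim N0 = enat (complex_vector.dim N0)" using B(1) N0B by (auto simp: cdim_def)
    moreover have "cdim N = enat (complex_vector.dim N)" using B by (auto simp: cdim_def)
    ultimately show ?thesis using A(4) by (simp add: N0_def one_enat_def)
  next
    case False
    then have "cdim N = \<infinity>" unfolding cdim_def by (rule if_not_P)
    moreover have "\<nexists>B. finite B \<and> N0 \<subseteq> complex_vector.span B"
      using split False by (meson finite_insert)
    then have "cdim N0 = \<infinity>" unfolding cdim_def by (rule if_not_P)
    ultimately show ?thesis by (simp add: N0_def)
  qed
qed

lemma subspace_kernel: "bounded_clinear S \<Longrightarrow> complex_vector.subspace {x. S x = 0}"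
  by (rule complex_vector.subspaceI)
    (auto simp: bounded_clinear_def linear_add linear_0 bounded_linear.linear)

lemma subspace_range: "bounded_clinear S \<Longrightarrow> complex_vector.subspace (range S)"
  using module_hom.subspace_image[OF module_hom_iff_linear[THEN iffD2, OF bounded_clinear_imp_linear] complex_vector.subspace_UNIV] .

lemma nullity_eq_0_iff:
  assumes "bounded_clinear S" shows "nullity S = 0 \<longleftrightarrow> inj S"
proof -
  have "nullity S = 0 \<longleftrightarrow> {x. S x = 0} \<subseteq> {0}"
  proof
    assume 0: "nullity S = 0"
    have "\<exists>B. finite B \<and> {x. S x = 0} \<subseteq> complex_vector.span B"
    proof (rule ccontr)
      assume "\<not> ?thesis"
      then have "nullity S = \<infinity>" unfolding nullity_def cdim_def by (rule if_not_P)
      with 0 show False by simp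
    qed
    then obtain B where B: "finite B" "{x. S x = 0} \<subseteq> complex_vector.span B" by blast
    then have d0: "complex_vector.dim {x. S x = 0} = 0"
      using 0 by (auto simp: nullity_def cdim_def zero_enat_def split: if_splits)
    obtain A where A: "A \<subseteq> {x. S x = 0}" "complex_vector.independent A"
      "{x. S x = 0} \<subseteq> complex_vector.span A" "card A = complex_vector.dim {x. S x = 0}"
      by (rule complex_vector.basis_exists)
    have "finite A" using complex_vector.independent_span_bound[OF B(1) A(2)] A(1) B(2) by blast
    then show "{x. S x = 0} \<subseteq> {0}" using A(3,4) d0 by simp
  next
    assume "{x. S x = 0} \<subseteq> {0}"
    then have sp: "{x. S x = 0} \<subseteq> complex_vector.span {}" by simp
    then have "complex_vector.dim {x. S x = 0} = 0"
      using complex_vector.dim_le_card[OF sp] by simp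
    then show "nullity S = 0" using sp unfolding nullity_def cdim_def
      by (auto simp: zero_enat_def intro!: exI[of _ "{}"])
  qed
  also have "\<dots> \<longleftrightarrow> inj S"
    unfolding linear_injective_0[OF bounded_linear.linear[OF assms[unfolded bounded_clinear_def, THEN conjunct1]]]
    by auto
  finally show ?thesis .
qed

lemma deficiency_eq_0_iff: "bounded_clinear S \<Longrightarrow> deficiency S = 0 \<longleftrightarrow> surj S"
  unfolding deficiency_def by (rule ccodim_eq_0_iff[OF subspace_range])

text \<open>With a bounded functional \<open>f\<close> such that \<open>f e = 1\<close>, the operator \<open>S + f c\<close> trades one dimension
  of the kernel for one of the cokernel: its kernel is the kernel of \<open>f\<close> inside that of \<open>S\<close>, since
  \<open>c\<close> is not in the range of \<open>S\<close>, and its range is that of \<open>S\<close> enlarged by \<open>c\<close>, since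
  adding multiples of \<open>e\<close> changes the value of \<open>f\<close> arbitrarily without changing that of \<open>S\<close>.\<close>
lemma rank_one_reduction:
  fixes S :: "'a::complex_normed_vector \<Rightarrow> 'a"
  assumes S: "bounded_clinear S" and cl: "closed (range S)"
    and e: "S e = 0" "e \<noteq> 0" and c: "c \<notin> range S"
  obtains R where "finite_rank R" "closed (range (\<lambda>x. S x + R x))"
    "nullity S = nullity (\<lambda>x. S x + R x) + 1"
    "deficiency S = deficiency (\<lambda>x. S x + R x) + 1"
proof -
  obtain f :: "'a \<Rightarrow> complex" where f: "bounded_linear f" "\<And>a x. f (a *\<^sub>C x) = a * f x" "f e = 1"
    using ex_bounded_functional[OF e(2)] by blast
  interpret f: bounded_linear f by fact
  interpret S: Vector_Spaces.linear scaleC scaleC S using S by (rule bounded_clinear_imp_linear)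
  define R where "R x = f x *\<^sub>C c" for x
  have "bounded_clinear R"
    unfolding bounded_clinear_def
  proof (intro conjI allI)
    obtain K where K: "\<And>x. norm (f x) \<le> norm x * K" using f.bounded by blast
    show "bounded_linear R"
    proof (rule bounded_linear_intro[where K = "K * norm c"])
      show "norm (R x) \<le> norm x * (K * norm c)" for x
        using mult_right_mono[OF K[of x], of "norm c"] by (simp add: R_def norm_scaleC mult.assoc)
      show "R (r *\<^sub>R x) = r *\<^sub>R R x" for r x
        using f(2)[of "of_real r" x] by (simp add: R_def scaleC_scaleC flip: scaleC_of_real)
    qed (simp add: R_def f.add scaleC_add_left)
    show "R (a *\<^sub>C x) = a *\<^sub>C R x" for a x by (simp add: R_def f(2) scaleC_scaleC)
  qed
  moreover have "range R \<subseteq> complex_vector.span {c}"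
    by (auto simp: R_def intro: complex_vector.span_scale complex_vector.span_base)
  ultimately have fr: "finite_rank R" unfolding finite_rank_def by blast
  have ran: "range (\<lambda>x. S x + R x) = {r + a *\<^sub>C c | r a. r \<in> range S}"
  proof (intro antisym subsetI)
    fix y assume "y \<in> {r + a *\<^sub>C c | r a. r \<in> range S}"
    then obtain x a where y: "y = S x + a *\<^sub>C c" by blast
    have "S (x + (a - f x) *\<^sub>C e) = S x" "f (x + (a - f x) *\<^sub>C e) = a"
      by (simp_all add: S.add S.scale e f.add f)
    then have "y = S (x + (a - f x) *\<^sub>C e) + R (x + (a - f x) *\<^sub>C e)" by (simp add: y R_def)
    then show "y \<in> range (\<lambda>x. S x + R x)" by blast
  qed (auto simp: R_def)
  have ker: "{x. S x + R x = 0} = {x \<in> {x. S x = 0}. f x = 0}"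
  proof -
    have "f x = 0" if "S x + R x = 0" for x
    proof (rule ccontr)
      assume "f x \<noteq> 0"
      moreover have "f x *\<^sub>C c = - S x" using that by (simp add: R_def add_eq_0_iff)
      ultimately have "c = (- inverse (f x)) *\<^sub>C S x"
        by (metis complex_vector.scale_minus_left complex_vector.scale_minus_right
            complex_vector.scale_one left_inverse scaleC_scaleC)
      also have "\<dots> = S ((- inverse (f x)) *\<^sub>C x)" by (rule S.scale[symmetric])
      finally show False using c by blast
    qed
    then have "S x + R x = 0 \<longleftrightarrow> S x = 0 \<and> f x = 0" for x
      by (metis R_def add.right_neutral complex_vector.scale_zero_left)
    then show ?thesis by simp
  qed
  show thesis
  proof (rule that[OF fr])
    show "closed (range (\<lambda>x. S x + R x))"
      unfolding ran by (rule closed_add_line[OF cl subspace_range[OF S] c])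
    show "nullity S = nullity (\<lambda>x. S x + R x) + 1"
      unfolding nullity_def ker
      by (rule cdim_kernel_functional[OF subspace_kernel[OF S]]) (use e f f.add in auto)
    show "deficiency S = deficiency (\<lambda>x. S x + R x) + 1"
      unfolding deficiency_def ran by (rule ccodim_add_line[OF subspace_range[OF S] c])
  qed
qed

text \<open>Working with one kernel vector at a time keeps every step a rank-one perturbation. The
  inequality between nullity and deficiency guarantees that the range does not become the whole
  space before the kernel is used up.\<close>
lemma finite_rank_reduction:
  fixes S :: "'a::cbanach \<Rightarrow> 'a"
  assumes "bounded_clinear S" "closed (range S)" "nullity S = enat n" "enat n \<le> deficiency S"
  shows "\<exists>F. finite_rank F \<and> bounded_below (\<lambda>x. S x + F x) \<and>
    (surj (\<lambda>x. S x + F x) \<longleftrightarrow> deficiency S = enat n)"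
  using assms
proof (induction n arbitrary: S)
  case 0
  then have "inj S" using nullity_eq_0_iff[OF 0(1)] by (simp add: zero_enat_def)
  then have "bounded_below S"
    using 0 bounded_below_iff_inj_closed_range unfolding bounded_clinear_def by blast
  moreover have "surj S \<longleftrightarrow> deficiency S = enat 0"
    using deficiency_eq_0_iff[OF 0(1)] by (simp add: zero_enat_def)
  ultimately show ?case
    by (intro exI[of _ "\<lambda>x. 0"]) (simp add: finite_rank_zero)
next
  case (Suc n)
  have "nullity S \<noteq> 0" using Suc.prems by (simp add: zero_enat_def)
  then have "\<not> inj S" using nullity_eq_0_iff[OF Suc.prems(1)] by blast
  then obtain e where e: "S e = 0" "e \<noteq> 0"
    using linear_injective_0[of S] Suc.prems(1) bounded_linear.linear[of S]
    unfolding bounded_clinear_def by metis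
  have "deficiency S \<noteq> 0" using Suc.prems by (auto simp: zero_enat_def)
  then obtain c where c: "c \<notin> range S" using deficiency_eq_0_iff[OF Suc.prems(1)] by blast
  obtain R where R: "finite_rank R" "closed (range (\<lambda>x. S x + R x))"
    "nullity S = nullity (\<lambda>x. S x + R x) + 1"
    "deficiency S = deficiency (\<lambda>x. S x + R x) + 1"
    by (rule rank_one_reduction[OF Suc.prems(1,2) e c])
  define S' where "S' = (\<lambda>x. S x + R x)"
  have S': "bounded_clinear S'" unfolding S'_def
    using Suc.prems(1) R(1) by (intro bounded_clinear_add) (simp_all add: finite_rank_def)
  have nul: "nullity S' + 1 = enat (Suc n)" and dfc: "deficiency S = deficiency S' + 1"
    using R(3,4) Suc.prems(3) by (simp_all add: S'_def)
  have n: "nullity S' = enat n" using nul by (cases "nullity S'") (auto simp: one_enat_def)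
  have m: "enat n \<le> deficiency S'"
    using dfc Suc.prems(4) by (cases "deficiency S'") (auto simp: one_enat_def)
  have eq: "deficiency S = enat (Suc n) \<longleftrightarrow> deficiency S' = enat n"
    using dfc by (cases "deficiency S'") (auto simp: one_enat_def)
  obtain F where F: "finite_rank F" "bounded_below (\<lambda>x. S' x + F x)"
    "surj (\<lambda>x. S' x + F x) \<longleftrightarrow> deficiency S' = enat n"
    using Suc.IH[OF S' _ n m] R(2)[folded S'_def] by blast
  have SF: "(\<lambda>x. S' x + F x) = (\<lambda>x. S x + (R x + F x))" by (simp add: S'_def add.assoc)
  show ?case
    using finite_rank_add[OF R(1) F(1)] F(2,3) unfolding SF eq[symmetric]
    by (intro exI[of _ "\<lambda>x. R x + F x"] conjI)
qed

section \<open>Parts of the spectrum\<close>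

lemma op_shift_change: "op_shift T m x = op_shift T l x + (l - m) *\<^sub>C x"
  by (simp add: op_shift_def complex_vector.scale_left_diff_distrib)

lemma notin_spectrum_iff:
  assumes T: "bounded_clinear T"
  shows "l \<notin> spectrum T \<longleftrightarrow> bounded_below (op_shift T l) \<and> surj (op_shift T l)"
proof
  define S where "S = op_shift T l"
  assume "l \<notin> spectrum T"
  then obtain R where R: "bounded_clinear R" "R \<circ> S = id" "S \<circ> R = id"
    by (auto simp: spectrum_def S_def)
  obtain K where K: "0 < K" "\<And>y. norm (R y) \<le> norm y * K"
    using R(1) bounded_linear.pos_bounded unfolding bounded_clinear_def by blast
  have "inverse K * norm x \<le> norm (S x)" for x
    using K(2)[of "S x"] K(1) R(2) by (simp add: fun_eq_iff field_simps)
  then have "bounded_below S" unfolding bounded_below_def using K(1) by (metis positive_imp_inverse_positive)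
  moreover have "surj S" using R(3) by (metis surj_def comp_apply id_apply)
  ultimately show "bounded_below (op_shift T l) \<and> surj (op_shift T l)" by (simp add: S_def)
next
  define S where "S = op_shift T l"
  assume "bounded_below (op_shift T l) \<and> surj (op_shift T l)"
  then obtain c where c: "0 < c" "\<And>x. c * norm x \<le> norm (S x)" and surj: "surj S"
    by (auto simp: bounded_below_def S_def)
  have S: "bounded_clinear S" unfolding S_def by (rule bounded_clinear_op_shift[OF T])
  interpret S: Vector_Spaces.linear scaleC scaleC S using S by (rule bounded_clinear_imp_linear)
  have inj: "S x = S y \<Longrightarrow> x = y" for x y
    using c(2)[of "x - y"] c(1) by (simp add: S.diff mult_le_0_iff)
  define R where "R = inv S"
  have SR: "S (R y) = y" for y using surj by (simp add: R_def surj_f_inv_f)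
  have RS: "R (S x) = x" for x using SR inj by blast
  have scale: "R (a *\<^sub>C y) = a *\<^sub>C R y" for a y by (rule inj) (simp add: SR S.scale)
  have "bounded_clinear R"
    unfolding bounded_clinear_def
  proof (intro conjI allI scale)
    show "bounded_linear R"
    proof (rule bounded_linear_intro[where K = "inverse c"])
      show "R (x + y) = R x + R y" for x y by (rule inj) (simp add: SR S.add)
      show "R (r *\<^sub>R x) = r *\<^sub>R R x" for r x by (simp add: scale flip: scaleC_of_real)
      show "norm (R x) \<le> norm x * inverse c" for x
        using c(2)[of "R x"] c(1) by (simp add: SR field_simps)
    qed
  qed
  then show "l \<notin> spectrum T"
    using SR RS by (auto simp: spectrum_def S_def fun_eq_iff intro!: exI[of _ R])
qed

lemma notin_approx_point_spectrum_iff: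
  fixes T :: "'a::complex_normed_vector \<Rightarrow> 'a"
  assumes T: "bounded_clinear T"
  shows "l \<notin> approx_point_spectrum T \<longleftrightarrow> bounded_below (op_shift T l)"
proof
  define S where "S = op_shift T l"
  have S: "bounded_clinear S" unfolding S_def by (rule bounded_clinear_op_shift[OF T])
  interpret bounded_linear S using S by (simp add: bounded_clinear_def)
  {
    assume "l \<notin> approx_point_spectrum T"
    then have none: "\<And>x :: nat \<Rightarrow> 'a. (\<And>n. norm (x n) = 1) \<Longrightarrow> \<not> (\<lambda>n. S (x n)) \<longlonglongrightarrow> 0"
      by (auto simp: approx_point_spectrum_def S_def)
    show "bounded_below (op_shift T l)"
    proof (rule ccontr)
      assume "\<not> bounded_below (op_shift T l)"
      then have "\<forall>c>0. \<exists>x. norm (S x) < c * norm x"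
        unfolding bounded_below_def S_def by (auto simp: not_le)
      then have "\<exists>x. norm (S x) < inverse (real (Suc n)) * norm x" for n by simp
      then obtain x where x: "\<And>n. norm (S (x n)) < inverse (real (Suc n)) * norm (x n)" by metis
      have nz: "x n \<noteq> 0" for n using x[of n] by (auto simp: zero)
      define y where "y n = inverse (norm (x n)) *\<^sub>R x n" for n
      have "norm (y n) = 1" for n using nz by (simp add: y_def)
      moreover have "(\<lambda>n. S (y n)) \<longlonglongrightarrow> 0"
      proof (rule Lim_null_comparison[OF _ LIMSEQ_inverse_real_of_nat])
        have "norm (S (y n)) \<le> inverse (real (Suc n))" for n
          using x[of n] nz[of n] by (simp add: y_def scaleR field_simps)
        then show "\<forall>\<^sub>F n in sequentially. norm (S (y n)) \<le> inverse (real (Suc n))" by simp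
      qed
      ultimately show False using none by blast
    qed
  next
    assume "bounded_below (op_shift T l)"
    then obtain c where c: "0 < c" "\<And>x. c * norm x \<le> norm (S x)" by (auto simp: bounded_below_def S_def)
    show "l \<notin> approx_point_spectrum T"
    proof
      assume "l \<in> approx_point_spectrum T"
      then obtain x where x: "\<And>n. norm (x n) = 1" "(\<lambda>n. S (x n)) \<longlonglongrightarrow> 0"
        by (auto simp: approx_point_spectrum_def S_def)
      have "c \<le> 0"
      proof (rule LIMSEQ_le_const)
        show "(\<lambda>n. norm (S (x n))) \<longlonglongrightarrow> 0" using x(2) by (rule tendsto_norm_zero)
        show "\<exists>N. \<forall>n\<ge>N. c \<le> norm (S (x n))" using c(2)[of "x _"] x(1) by auto
      qed
      then show False using c(1) by simp
    qed
  }
qed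

lemma point_spectrum_iff_not_inj:
  assumes "bounded_clinear T"
  shows "l \<in> point_spectrum T \<longleftrightarrow> \<not> inj (op_shift T l)"
proof -
  have "linear (op_shift T l)"
    using bounded_clinear_op_shift[OF assms] bounded_linear.linear unfolding bounded_clinear_def by blast
  then show ?thesis by (auto simp: linear_injective_0 point_spectrum_def op_shift_def)
qed

lemma notin_upper_semi_weyl_spectrum_iff:
  "l \<notin> upper_semi_weyl_spectrum T \<longleftrightarrow> closed (range (op_shift T l)) \<and>
    (\<exists>n. nullity (op_shift T l) = enat n \<and> enat n \<le> deficiency (op_shift T l))"
  unfolding upper_semi_weyl_spectrum_def upper_semi_fredholm_def fredholm_index_def
  by (cases "nullity (op_shift T l)"; cases "deficiency (op_shift T l)") auto

lemma notin_weyl_spectrum_iff: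
  "l \<notin> weyl_spectrum T \<longleftrightarrow> closed (range (op_shift T l)) \<and>
    (\<exists>n. nullity (op_shift T l) = enat n \<and> deficiency (op_shift T l) = enat n)"
  unfolding weyl_spectrum_def fredholm_def upper_semi_fredholm_def fredholm_index_def
  by (cases "nullity (op_shift T l)"; cases "deficiency (op_shift T l)") auto

lemma upper_semi_weyl_subset_weyl: "upper_semi_weyl_spectrum T \<subseteq> weyl_spectrum T"
  using notin_upper_semi_weyl_spectrum_iff notin_weyl_spectrum_iff
  by (metis order_refl subsetI)

lemma isolated_in_closure_Compl:
  fixes l :: complex
  assumes "l isolated_in A" shows "l \<in> closure (- A)"
proof -
  obtain d where d: "0 < d" "\<And>y. y \<in> A \<Longrightarrow> dist l y < d \<Longrightarrow> y = l"
    using assms by (rule isolated_inE_dist) blast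
  show ?thesis
    unfolding closure_approachable
  proof (intro allI impI)
    fix \<epsilon> :: real assume \<epsilon>: "0 < \<epsilon>"
    define y where "y = l + of_real (min d \<epsilon> / 2)"
    have "dist l y = min d \<epsilon> / 2" using d(1) \<epsilon> by (simp add: y_def dist_norm)
    moreover have "0 < min d \<epsilon>" "min d \<epsilon> \<le> d" "min d \<epsilon> \<le> \<epsilon>" using d(1) \<epsilon> by auto
    ultimately have "0 < dist l y" "dist l y < d" "dist l y < \<epsilon>" by linarith+
    then have "dist l y < d" "dist y l < \<epsilon>" "y \<noteq> l" by (auto simp: dist_commute)
    then show "\<exists>y\<in>- A. dist y l < \<epsilon>" using d(2) by blast
  qed
qed

context
  fixes T :: "'a::cbanach \<Rightarrow> 'a"
  assumes T: "bounded_clinear T"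
begin

lemma bounded_below_op_shift_iff:
  "bounded_below (op_shift T l) \<longleftrightarrow> inj (op_shift T l) \<and> closed (range (op_shift T l))"
  using bounded_clinear_op_shift[OF T] by (simp add: bounded_clinear_def bounded_below_iff_inj_closed_range)

lemma point_subset_approx_point: "point_spectrum T \<subseteq> approx_point_spectrum T"
  using notin_approx_point_spectrum_iff[OF T] point_spectrum_iff_not_inj[OF T] bounded_below_op_shift_iff
  by blast

lemma approx_point_subset_spectrum: "approx_point_spectrum T \<subseteq> spectrum T"
  using notin_approx_point_spectrum_iff[OF T] notin_spectrum_iff[OF T] by blast

lemma weyl_subset_spectrum: "weyl_spectrum T \<subseteq> spectrum T"
proof
  fix l assume l: "l \<in> weyl_spectrum T"
  show "l \<in> spectrum T"
  proof (rule ccontr)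
    assume "l \<notin> spectrum T"
    then have "inj (op_shift T l)" "closed (range (op_shift T l))" "surj (op_shift T l)"
      using notin_spectrum_iff[OF T] bounded_below_op_shift_iff by blast+
    then have "closed (range (op_shift T l))" "nullity (op_shift T l) = enat 0"
      "deficiency (op_shift T l) = enat 0"
      using nullity_eq_0_iff[OF bounded_clinear_op_shift[OF T]]
        deficiency_eq_0_iff[OF bounded_clinear_op_shift[OF T]] by (simp_all add: zero_enat_def)
    then show False using l notin_weyl_spectrum_iff by blast
  qed
qed

lemma spectrum_minus_approx_point_subset_weyl:
  "spectrum T - approx_point_spectrum T \<subseteq> weyl_spectrum T - upper_semi_weyl_spectrum T"
proof
  fix l assume l: "l \<in> spectrum T - approx_point_spectrum T"
  then have inj: "inj (op_shift T l)" and cl: "closed (range (op_shift T l))"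
    using notin_approx_point_spectrum_iff[OF T] bounded_below_op_shift_iff by auto
  have nul: "nullity (op_shift T l) = enat 0"
    using inj nullity_eq_0_iff[OF bounded_clinear_op_shift[OF T]] by (simp add: zero_enat_def)
  have "deficiency (op_shift T l) \<noteq> enat 0"
    using l notin_approx_point_spectrum_iff[OF T] notin_spectrum_iff[OF T]
      deficiency_eq_0_iff[OF bounded_clinear_op_shift[OF T]] by (auto simp: zero_enat_def)
  then show "l \<in> weyl_spectrum T - upper_semi_weyl_spectrum T"
    using nul cl notin_weyl_spectrum_iff[of l T] notin_upper_semi_weyl_spectrum_iff[of l T]
    by (metis DiffI enat.inject i0_lb zero_enat_def)
qed

lemma spectrum_minus_weyl_subset_point: "spectrum T - weyl_spectrum T \<subseteq> point_spectrum T"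
proof
  fix l assume l: "l \<in> spectrum T - weyl_spectrum T"
  then obtain n where n: "closed (range (op_shift T l))" "nullity (op_shift T l) = enat n"
    "deficiency (op_shift T l) = enat n" using notin_weyl_spectrum_iff by blast
  show "l \<in> point_spectrum T"
  proof (rule ccontr)
    assume "l \<notin> point_spectrum T"
    then have inj: "inj (op_shift T l)" using point_spectrum_iff_not_inj[OF T] by blast
    then have "surj (op_shift T l)"
      using n nullity_eq_0_iff[OF bounded_clinear_op_shift[OF T], of l]
        deficiency_eq_0_iff[OF bounded_clinear_op_shift[OF T], of l] by simp
    then show False using l inj n(1) notin_spectrum_iff[OF T] bounded_below_op_shift_iff by blast
  qed
qed

text \<open>Choose \<open>F\<close> of finite rank with \<open>T - l + F\<close> invertible. Then \<open>T - m + F\<close> is invertible for \<open>m\<close>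
  near \<open>l\<close>, so \<open>T - m\<close> is an invertible operator minus one of finite rank, and is onto as soon as it
  is injective.\<close>
lemma spectrum_eq_approx_point_near_weyl:
  assumes l: "l \<notin> weyl_spectrum T"
  obtains \<delta> where "0 < \<delta>" "\<And>m. dist l m < \<delta> \<Longrightarrow> m \<notin> approx_point_spectrum T \<Longrightarrow> m \<notin> spectrum T"
proof -
  define S where "S = op_shift T l"
  obtain n where n: "closed (range S)" "nullity S = enat n" "deficiency S = enat n"
    using l notin_weyl_spectrum_iff S_def by blast
  obtain F where F: "finite_rank F" "bounded_below (\<lambda>x. S x + F x)" "surj (\<lambda>x. S x + F x)"
    using finite_rank_reduction[of S n] n bounded_clinear_op_shift[OF T] by (auto simp: S_def)
  define G where "G = (\<lambda>x. S x + F x)"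
  have G: "bounded_clinear G" unfolding G_def S_def
    using F(1) bounded_clinear_op_shift[OF T] by (intro bounded_clinear_add) (auto simp: finite_rank_def)
  obtain c where c: "0 < c" "\<And>x. c * norm x \<le> norm (G x)"
    using F(2) by (auto simp: bounded_below_def G_def)
  show thesis
  proof (rule that[OF c(1)])
    fix m assume m: "dist l m < c" "m \<notin> approx_point_spectrum T"
    define G' where "G' = (\<lambda>x. G x + (l - m) *\<^sub>C x)"
    have lm: "cmod (l - m) < c" using m(1) by (simp add: dist_norm)
    have G': "bounded_clinear G'" unfolding G'_def by (intro bounded_clinear_add G bounded_clinear_scaleC)
    have "surj G'" unfolding G'_def
      by (rule surj_perturbation[OF G _ c]) (use F(3) lm in \<open>simp_all add: G_def\<close>)
    moreover have "bounded_below G'"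
      unfolding bounded_below_def G'_def using bounded_below_perturbation[OF c(2), of "l - m"] lm
      by (intro exI[of _ "c - cmod (l - m)"]) simp
    then have "inj G'" using G' by (simp add: bounded_clinear_def bounded_below_iff_inj_closed_range)
    ultimately have "bij G'" by (simp add: bij_def)
    have eq: "op_shift T m = (\<lambda>x. G' x + - F x)"
      by (auto simp: G'_def G_def S_def op_shift_change[of T m _ l] algebra_simps)
    have bb: "bounded_below (op_shift T m)" using m(2) notin_approx_point_spectrum_iff[OF T] by blast
    then have inj: "inj (op_shift T m)" using bounded_below_op_shift_iff by blast
    have "surj (op_shift T m)"
      using inj unfolding eq
      by (rule bij_plus_finite_rank_inj_imp_surj[OF G' \<open>bij G'\<close> finite_rank_neg[OF F(1)]])
    with bb show "m \<notin> spectrum T" using notin_spectrum_iff[OF T] by blast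
  qed
qed

text \<open>Choose \<open>F\<close> of finite rank with \<open>T - l + F\<close> bounded below. For a resolvent point \<open>m\<close> near \<open>l\<close>,
  \<open>T - m + F\<close> is still injective, and it is an invertible operator plus one of finite rank, hence
  onto. Perturbing back shows that \<open>T - l + F\<close> is onto, which means that the index is \<open>0\<close>.\<close>
lemma upper_semi_weyl_near_resolvent_imp_weyl:
  assumes l: "l \<notin> upper_semi_weyl_spectrum T" and cl: "l \<in> closure (- spectrum T)"
  shows "l \<notin> weyl_spectrum T"
proof -
  define S where "S = op_shift T l"
  obtain n where n: "closed (range S)" "nullity S = enat n" "enat n \<le> deficiency S"
    using l notin_upper_semi_weyl_spectrum_iff S_def by blast
  obtain F where F: "finite_rank F" "bounded_below (\<lambda>x. S x + F x)"
    "surj (\<lambda>x. S x + F x) \<longleftrightarrow> deficiency S = enat n"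
    using finite_rank_reduction[of S n] n bounded_clinear_op_shift[OF T] by (auto simp: S_def)
  obtain c where c: "0 < c" "\<And>x. c * norm x \<le> norm (S x + F x)"
    using F(2) by (auto simp: bounded_below_def)
  \<comment> \<open>Moving from \<open>l\<close> to \<open>m\<close> lowers the constant \<open>c\<close> by \<open>dist m l\<close>; moving back requires \<open>dist m l\<close> to be
    below what is left, whence the \<open>2\<close>.\<close>
  obtain m where m: "m \<notin> spectrum T" "dist m l < c / 2"
    using cl c(1) unfolding closure_approachable by (metis ComplD half_gt_zero)
  define G where "G = (\<lambda>x. op_shift T m x + F x)"
  have G: "bounded_clinear G" unfolding G_def
    using F(1) bounded_clinear_op_shift[OF T] by (intro bounded_clinear_add) (auto simp: finite_rank_def)
  have GS: "G x = (S x + F x) + (l - m) *\<^sub>C x" "S x + F x = G x + (m - l) *\<^sub>C x" for x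
    by (simp_all add: G_def S_def op_shift_change[of T m x l] complex_vector.scale_left_diff_distrib algebra_simps)
  have low: "(c - cmod (l - m)) * norm x \<le> norm (G x)" for x
    unfolding GS(1) by (rule bounded_below_perturbation[OF c(2)])
  have small: "cmod (m - l) < c - cmod (l - m)"
    using m(2) norm_minus_commute[of m l] by (simp add: dist_norm)
  then have pos: "0 < c - cmod (l - m)" using norm_ge_zero[of "m - l"] by linarith
  then have "bounded_below G" using low unfolding bounded_below_def by blast
  then have "inj G" using G by (simp add: bounded_clinear_def bounded_below_iff_inj_closed_range)
  moreover have "bij (op_shift T m)"
    using m(1) notin_spectrum_iff[OF T] bounded_below_op_shift_iff by (auto simp: bij_def)
  ultimately have "surj G"
    unfolding G_def using bij_plus_finite_rank_inj_imp_surj[OF bounded_clinear_op_shift[OF T] _ F(1)] by blast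
  then have "surj (\<lambda>x. S x + F x)"
    unfolding GS(2) using surj_perturbation[OF G _ pos low small] by blast
  then show ?thesis using F(3) n notin_weyl_spectrum_iff S_def by blast
qed

end

section \<open>Isolated points and the two properties\<close>

context
  fixes T :: "'a::cbanach \<Rightarrow> 'a"
  assumes T: "bounded_clinear T"
begin

lemma E_subset_E_a: "E_set T \<subseteq> E_a_set T"
  using point_subset_approx_point[OF T] approx_point_subset_spectrum[OF T]
  unfolding E_set_def E_a_set_def isolated_points_def isolated_in_dist_Ex_iff by blast

lemma E_minus_upper_semi_weyl_subset_Delta:
  "E_set T - upper_semi_weyl_spectrum T \<subseteq> Delta T"
proof
  fix l assume l: "l \<in> E_set T - upper_semi_weyl_spectrum T"
  then have "l isolated_in spectrum T" by (simp add: E_set_def isolated_points_def)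
  then have "l \<in> spectrum T" "l \<in> closure (- spectrum T)"
    by (auto simp: isolated_in_def isolated_in_closure_Compl)
  then show "l \<in> Delta T" using l upper_semi_weyl_near_resolvent_imp_weyl[OF T] by (simp add: Delta_def)
qed

lemma E_a_minus_weyl_subset_E: "E_a_set T - weyl_spectrum T \<subseteq> E_set T"
proof
  fix l assume l: "l \<in> E_a_set T - weyl_spectrum T"
  then have iso: "l isolated_in approx_point_spectrum T" and p: "l \<in> point_spectrum T"
    by (auto simp: E_a_set_def isolated_points_def)
  obtain d where d: "0 < d" "\<And>y. y \<in> approx_point_spectrum T \<Longrightarrow> dist l y < d \<Longrightarrow> y = l"
    using iso by (rule isolated_inE_dist) blast
  obtain \<delta> where \<delta>: "0 < \<delta>" "\<And>m. dist l m < \<delta> \<Longrightarrow> m \<notin> approx_point_spectrum T \<Longrightarrow> m \<notin> spectrum T"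
    using spectrum_eq_approx_point_near_weyl[OF T] l by blast
  have "l \<in> spectrum T" using p point_subset_approx_point[OF T] approx_point_subset_spectrum[OF T] by blast
  moreover have "y = l" if "y \<in> spectrum T" "dist l y < min d \<delta>" for y
    using that d(2) \<delta>(2) by auto
  ultimately have "l isolated_in spectrum T"
    unfolding isolated_in_dist_Ex_iff using d(1) \<delta>(1) by (intro conjI exI[of _ "min d \<delta>"]) auto
  then show "l \<in> E_set T" using p by (simp add: E_set_def isolated_points_def)
qed

lemma Delta_subset_Delta_a: "Delta T \<subseteq> Delta_a T"
  using spectrum_minus_weyl_subset_point[OF T] point_subset_approx_point[OF T] upper_semi_weyl_subset_weyl[of T]
  unfolding Delta_def Delta_a_def by blast

end

theorem theorem3p14:
  fixes T :: "'a::cbanach \<Rightarrow> 'a"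
  assumes "cdim (UNIV :: 'a set) = \<infinity>"
    and "bounded_clinear T"
  shows "((property_UWE T \<and> E_a_set T \<inter> upper_semi_weyl_spectrum T = {}) \<longleftrightarrow>
          (property_ZEa T \<and>
           weyl_spectrum T - upper_semi_weyl_spectrum T = spectrum T - approx_point_spectrum T)) \<and>
         ((property_ZEa T \<and>
           weyl_spectrum T - upper_semi_weyl_spectrum T = spectrum T - approx_point_spectrum T) \<longleftrightarrow>
          (property_ZEa T \<and> Delta_a T \<inter> weyl_spectrum T = {}))"
proof -
  note T = assms(2)
  note subs = approx_point_subset_spectrum[OF T] weyl_subset_spectrum[OF T]
    spectrum_minus_approx_point_subset_weyl[OF T]
  have ii_iii: "weyl_spectrum T - upper_semi_weyl_spectrum T = spectrum T - approx_point_spectrum T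
      \<longleftrightarrow> Delta_a T \<inter> weyl_spectrum T = {}"
    using subs unfolding Delta_a_def by blast
  have i_iii: "property_UWE T \<and> E_a_set T \<inter> upper_semi_weyl_spectrum T = {}
      \<longleftrightarrow> property_ZEa T \<and> Delta_a T \<inter> weyl_spectrum T = {}" (is "?i \<longleftrightarrow> ?iii")
  proof
    assume i: ?i
    then have Da: "Delta_a T = E_set T" by (simp add: property_UWE_def)
    have "E_a_set T \<subseteq> Delta_a T"
      using i by (auto simp: Delta_a_def E_a_set_def isolated_points_def isolated_in_def)
    with Da have "E_a_set T = E_set T" using E_subset_E_a[OF T] by blast
    moreover have "E_set T \<subseteq> Delta T"
      using Da E_minus_upper_semi_weyl_subset_Delta[OF T] by (auto simp: Delta_a_def)
    moreover have "Delta T \<subseteq> E_set T" using Delta_subset_Delta_a[OF T] Da by simp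
    ultimately have "E_a_set T = E_set T" "Delta T = E_set T" by blast+
    moreover from this have "Delta_a T \<inter> weyl_spectrum T = {}"
      using Da unfolding Delta_def by blast
    ultimately show ?iii by (simp add: property_ZEa_def)
  next
    assume iii: ?iii
    then have D: "Delta T = E_a_set T" by (simp add: property_ZEa_def)
    have "Delta_a T \<subseteq> Delta T" using iii subs(1) unfolding Delta_a_def Delta_def by blast
    with Delta_subset_Delta_a[OF T] D have Da: "Delta_a T = E_a_set T" by blast
    have "E_a_set T \<subseteq> E_set T"
      using E_a_minus_weyl_subset_E[OF T] D unfolding Delta_def by blast
    then have "E_set T = E_a_set T" using E_subset_E_a[OF T] by blast
    moreover from this have "E_a_set T \<inter> upper_semi_weyl_spectrum T = {}"
      using Da unfolding Delta_a_def by blast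
    ultimately show ?i using Da by (simp add: property_UWE_def)
  qed
  show ?thesis unfolding ii_iii i_iii by (intro conjI refl)
qed

end
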